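(* The $t$-uniform hypergraphicality problem, with the degree sequence given in compressed form, is fixed-parameter tractable parameterized by $(k,t)$. That is, there exist a function $f$, a polynomial $\mathrm{poly}$, and an algorithm which, given $t$ and an input $(\delta_1,n_1),\dots,(\delta_k,n_k)$ with pairwise distinct $\delta_1,\dots,\delta_k$, decides in time at most $f(k,t)\cdot \mathrm{poly}(L)$ whether the degree sequence of length $n=n_1+\cdots+n_k$ consisting of exactly $n_i$ terms equal to $\delta_i$ for each $i=1,\dots,k$ is $t$-hypergraphical, where $L$ is the total number of bits required to encode the integers $(\delta_1,n_1),\dots,(\delta_k,n_k)$.
   Context: A $t$-uniform hypergraph is a pair $H=(V,E)$ where $V$ is a finite set and $E\subseteq\binom{V}{t}$ (a set of $t$-element subsets of $V$, so no repeated hyperedges). The degree of a vertex $v$ is the number of hyperedges $e\in E$ with $v\in e$. A sequence $d=(d_1,\dots,d_n)$ of nonnegative integers is $t$-hypergraphical if there is a $t$-uniform hypergraph with vertex set $\{v_1,\dots,v_n\}$ in which $v_i$ has degree $d_i$ for all $i$. Compressed input: $\delta_1,\dots,\delta_k$ are the distinct degrees (nonnegative integers), and $n_i\ge 1$ is the number of vertices of degree $\delta_i$; all integers are written in binary. The input size $L$ is the total number of bits required to encode $(\delta_1,n_1),\dots,(\delta_k,n_k)$ (so $L$ is of order $\sum_i(\log\delta_i+\log n_i)$, not of order $n$). A problem is fixed-parameter tractable with parameter set $p$ if it can be solved in time $f(p)\cdot\mathrm{poly}(L)$; here $p=(k,t)$. *)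

theory Defs
  imports "HOL-Library.Log_Nat" "HOL-Library.Ramsey" "HOL-Computational_Algebra.Polynomial"
begin

text \<open>Uniform hypergraphs and their degree sequences. Vertex \<open>v\<^sub>i\<close> is represented by
  the position \<open>i\<close> in the degree list (counted from 0).\<close>

definition uniform_hypergraph :: "nat \<Rightarrow> 'a set \<Rightarrow> 'a set set \<Rightarrow> bool" where
  "uniform_hypergraph t V E \<longleftrightarrow> finite V \<and> E \<subseteq> nsets V t"

definition degree_in :: "'a set set \<Rightarrow> 'a \<Rightarrow> nat" where
  "degree_in E v = card {e \<in> E. v \<in> e}"

definition hypergraphical :: "nat \<Rightarrow> nat list \<Rightarrow> bool" where
  "hypergraphical t d \<longleftrightarrow>
     (\<exists>E. uniform_hypergraph t {..<length d} E \<and> (\<forall>i<length d. degree_in E i = d ! i))"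

text \<open>A compressed degree sequence is the list of the pairs \<open>(\<delta>\<^sub>i, n\<^sub>i)\<close>.\<close>

definition compressed :: "(nat \<times> nat) list \<Rightarrow> bool" where
  "compressed ds \<longleftrightarrow> distinct (map fst ds) \<and> (\<forall>(\<delta>, n) \<in> set ds. n \<ge> 1)"

definition expand :: "(nat \<times> nat) list \<Rightarrow> nat list" where
  "expand ds = concat (map (\<lambda>(\<delta>, n). replicate n \<delta>) ds)"

text \<open>Number of binary digits of the absolute value, where 0 takes one digit.\<close>

definition bit_size :: "int \<Rightarrow> nat" where
  "bit_size a = max 1 (floorlog 2 (nat \<bar>a\<bar>))"

definition input_size :: "(nat \<times> nat) list \<Rightarrow> nat" where
  "input_size ds = (\<Sum>(\<delta>, n) \<leftarrow> ds. bit_size (int \<delta>) + bit_size (int n))"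

text \<open>The model of computation is a random access machine with integer registers and
  logarithmic cost, presented as a structured programming language. Every operation is charged
  for the binary length of the integers it handles, memory addresses included; multiplication
  and division are charged for the schoolbook algorithms. Running times in this model
  are therefore polynomially related to those of multitape Turing machines.\<close>

type_synonym mem = "int \<Rightarrow> int"

datatype expr =
    Const int
  | Load expr
  | Add expr expr
  | Sub expr expr
  | Mul expr expr
  | Div expr expr

fun expr_val :: "expr \<Rightarrow> mem \<Rightarrow> int" where
  "expr_val (Const c) m = c"
| "expr_val (Load a) m = m (expr_val a m)"
| "expr_val (Add a b) m = expr_val a m + expr_val b m"
| "expr_val (Sub a b) m = expr_val a m - expr_val b m"
| "expr_val (Mul a b) m = expr_val a m * expr_val b m"
| "expr_val (Div a b) m = expr_val a m div expr_val b m"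

fun expr_time :: "expr \<Rightarrow> mem \<Rightarrow> nat" where
  "expr_time (Const c) m = bit_size c"
| "expr_time (Load a) m =
     expr_time a m + bit_size (expr_val a m) + bit_size (m (expr_val a m))"
| "expr_time (Add a b) m =
     expr_time a m + expr_time b m + bit_size (expr_val a m) + bit_size (expr_val b m)"
| "expr_time (Sub a b) m =
     expr_time a m + expr_time b m + bit_size (expr_val a m) + bit_size (expr_val b m)"
| "expr_time (Mul a b) m =
     expr_time a m + expr_time b m + bit_size (expr_val a m) * bit_size (expr_val b m)"
| "expr_time (Div a b) m =
     expr_time a m + expr_time b m + bit_size (expr_val a m) * bit_size (expr_val b m)"

text \<open>\<open>Store a e\<close> writes the value of \<open>e\<close> to the register addressed by \<open>a\<close>.
  The branch condition of \<open>Cond\<close> and \<open>While\<close> is that the expression is positive.\<close>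

datatype com =
    Skip
  | Store expr expr
  | Seq com com
  | Cond expr com com
  | While expr com

text \<open>\<open>exec c m T m'\<close>: started in memory \<open>m\<close>, the program \<open>c\<close> halts in
  memory \<open>m'\<close> after time \<open>T\<close>.\<close>

inductive exec :: "com \<Rightarrow> mem \<Rightarrow> nat \<Rightarrow> mem \<Rightarrow> bool" where
  Skip: "exec Skip m 1 m"
| Store: "exec (Store a e) m
     (expr_time a m + expr_time e m + bit_size (expr_val a m) + bit_size (expr_val e m))
     (m(expr_val a m := expr_val e m))"
| Seq: "exec c1 m T1 m1 \<Longrightarrow> exec c2 m1 T2 m2 \<Longrightarrow> exec (Seq c1 c2) m (T1 + T2) m2"
| Cond_true: "expr_val e m > 0 \<Longrightarrow> exec c1 m T m1 \<Longrightarrow>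
     exec (Cond e c1 c2) m (expr_time e m + bit_size (expr_val e m) + T) m1"
| Cond_false: "expr_val e m \<le> 0 \<Longrightarrow> exec c2 m T m1 \<Longrightarrow>
     exec (Cond e c1 c2) m (expr_time e m + bit_size (expr_val e m) + T) m1"
| While_true: "expr_val e m > 0 \<Longrightarrow> exec c m T1 m1 \<Longrightarrow> exec (While e c) m1 T2 m2 \<Longrightarrow>
     exec (While e c) m (expr_time e m + bit_size (expr_val e m) + T1 + T2) m2"
| While_false: "expr_val e m \<le> 0 \<Longrightarrow>
     exec (While e c) m (expr_time e m + bit_size (expr_val e m)) m"

inductive_cases exec_SkipE: "exec Skip m T m'"
inductive_cases exec_StoreE: "exec (Store a e) m T m'"
inductive_cases exec_SeqE: "exec (Seq c1 c2) m T m'"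
inductive_cases exec_CondE: "exec (Cond e c1 c2) m T m'"
inductive_cases exec_WhileE: "exec (While e c) m T m'"

lemma exec_deterministic:
  "exec c m T m1 \<Longrightarrow> exec c m T' m2 \<Longrightarrow> T' = T \<and> m2 = m1"
proof (induction arbitrary: T' m2 rule: exec.induct)
  case (Skip m)
  then show ?case by (auto elim: exec_SkipE)
next
  case (Store a e m)
  then show ?case by (auto elim: exec_StoreE)
next
  case (Seq c1 m T1 m1 c2 T2 m3)
  from Seq.prems show ?case
  proof (rule exec_SeqE)
    fix S1 n1 S2
    assume *: "T' = S1 + S2" "exec c1 m S1 n1" "exec c2 n1 S2 m2"
    from Seq.IH(1)[OF *(2)] have 1: "S1 = T1" "n1 = m1" by simp_all
    from Seq.IH(2)[OF *(3)[unfolded 1]] show ?thesis by (simp add: * 1)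
  qed
next
  case (Cond_true e m c1 T m1 c2)
  from Cond_true.prems show ?case
  proof (rule exec_CondE)
    fix S assume *: "T' = expr_time e m + bit_size (expr_val e m) + S" "exec c1 m S m2"
    from Cond_true.IH[OF *(2)] show ?thesis by (simp add: *)
  qed (use Cond_true.hyps in linarith)
next
  case (Cond_false e m c2 T m1 c1)
  from Cond_false.prems show ?case
  proof (rule exec_CondE)
    fix S assume *: "T' = expr_time e m + bit_size (expr_val e m) + S" "exec c2 m S m2"
    from Cond_false.IH[OF *(2)] show ?thesis by (simp add: *)
  qed (use Cond_false.hyps in linarith)
next
  case (While_true e m c T1 m1 T2 m3)
  from While_true.prems show ?case
  proof (rule exec_WhileE)
    fix S1 n1 S2
    assume *: "T' = expr_time e m + bit_size (expr_val e m) + S1 + S2"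
      "exec c m S1 n1" "exec (While e c) n1 S2 m2"
    from While_true.IH(1)[OF *(2)] have 1: "S1 = T1" "n1 = m1" by simp_all
    from While_true.IH(2)[OF *(3)[unfolded 1]] show ?thesis by (simp add: * 1)
  qed (use While_true.hyps in linarith)
next
  case (While_false e m c)
  from While_false.prems show ?case
    by (rule exec_WhileE) (use While_false.hyps in simp_all)
qed

text \<open>The input is placed in the registers 0, 1, 2, ..., all others being 0. The answer
  is left in register 0.\<close>

definition input_mem :: "int list \<Rightarrow> mem" where
  "input_mem xs a = (if 0 \<le> a \<and> a < int (length xs) then xs ! nat a else 0)"

definition decides_within :: "com \<Rightarrow> int list \<Rightarrow> bool \<Rightarrow> nat \<Rightarrow> bool" where
  "decides_within A xs P B \<longleftrightarrow>
     (\<exists>T m. exec A (input_mem xs) T m \<and> m 0 = (if P then 1 else 0) \<and> T \<le> B)"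

text \<open>Register contents \<open>t, k, \<delta>\<^sub>1, n\<^sub>1, \<dots>, \<delta>\<^sub>k, n\<^sub>k\<close>.\<close>

definition encode_input :: "nat \<Rightarrow> (nat \<times> nat) list \<Rightarrow> int list" where
  "encode_input t ds =
     int t # int (length ds) # concat (map (\<lambda>(\<delta>, n). [int \<delta>, int n]) ds)"

end

theory Submission
  imports Defs
begin

text \<open>Call the vector of the numbers of vertices that an edge has in each class of equal degrees its type.
  A hypergraph with \<open>x\<^sub>l\<close> edges of type \<open>l\<close> exists as soon as \<open>x\<^sub>l\<close> is at most a product of
  binomial coefficients, and exchanging vertices of the same class makes its degrees constant on the
  classes. So hypergraphicality is an integer program \<open>\<Sum>\<^sub>l a\<^sub>i\<^sub>l x\<^sub>l = n\<^sub>i \<delta>\<^sub>i\<close>, \<open>0 \<le> x\<^sub>l \<le> u\<^sub>l\<close>, in which the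
  number of variables, the number of equations and the coefficients are bounded in \<open>k\<close> and \<open>t\<close>; only the
  right hand sides are large. Reading these in binary from the least significant bit, a solution
  is an accepting run of a nondeterministic automaton whose states are the carries of the
  equations. The number of states depends only on \<open>k\<close> and \<open>t\<close>, and the number of rounds is
  linear in the size of the right hand sides. The set of reachable states is kept as a bit mask in one register.

  Each round is a term of a small language of bounded iterations whose loop bounds depend
  only on \<open>k\<close> and \<open>t\<close>. So the number of its steps is some function of \<open>k\<close> and \<open>t\<close>, which is not estimated further.\<close>

section \<open>Growth of register contents\<close>

text \<open>The obstacle is that a growth bound exponential in the number of steps is affordable
  within one round, where that number depends on \<open>k\<close> and \<open>t\<close> only, but not
  across all rounds, where it would be exponential in the input size. Therefore the memory between
  rounds is described exactly: it holds the input, a bound on the right hand sides, a power of 2 and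
  a bit mask whose length is the number of states. Every round starts from the same size bound, and
  quadratic cost per round times linearly many rounds gives a cubic polynomial. The automaton is
  finite because a carry stays below a bound on the coefficient sum of its equation, however many
  bits have been read. The upper bounds of the variables are products of binomial coefficients of
  huge numbers, but the lower arguments are at most \<open>t\<close>, so few operations compute
  them; slack variables then make them right hand sides like the degree sums of the classes.\<close>

lemma bit_size_ge1: "1 \<le> bit_size a"
  by (simp add: bit_size_def)

lemma bit_size_le_iff: "1 \<le> n \<Longrightarrow> bit_size a \<le> n \<longleftrightarrow> \<bar>a\<bar> < 2 ^ n"
  by (simp add: bit_size_def floorlog_le_iff nat_less_iff)

lemma abs_less_bit_size: "\<bar>a\<bar> < 2 ^ bit_size a"
  using bit_size_le_iff[OF bit_size_ge1, of a a] by simp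

lemma bit_size_mono: "\<bar>a\<bar> \<le> \<bar>b\<bar> \<Longrightarrow> bit_size a \<le> bit_size b"
  using bit_size_le_iff[OF bit_size_ge1, of a b] abs_less_bit_size[of b] by linarith

lemma bit_size_0 [simp]: "bit_size 0 = 1"
  by (simp add: bit_size_def floorlog_def)

lemma bit_size_mult: "bit_size (a * b) \<le> bit_size a + bit_size b"
proof -
  have "\<bar>a * b\<bar> < 2 ^ bit_size a * 2 ^ bit_size b"
    unfolding abs_mult by (intro mult_strict_mono' abs_less_bit_size) auto
  then show ?thesis
    using bit_size_ge1[of a] by (subst bit_size_le_iff) (auto simp: power_add)
qed

text \<open>Both powers of 2 are at least 2, and a sum of such numbers is at most their product. The
  form with absolute values covers addition and subtraction at once.\<close>

lemma bit_size_add_abs: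
  assumes "\<bar>c\<bar> \<le> \<bar>a\<bar> + \<bar>b\<bar>"
  shows "bit_size c \<le> bit_size a + bit_size b"
proof -
  have 2: "(2::int) \<le> 2 ^ bit_size x" for x
    using power_increasing[OF bit_size_ge1[of x], of "2::int"] by simp
  have "\<bar>c\<bar> < 2 ^ bit_size a + 2 ^ bit_size b"
    using assms abs_less_bit_size[of a] abs_less_bit_size[of b] by linarith
  also have "\<dots> \<le> 2 ^ bit_size a * 2 ^ bit_size b"
    using mult_mono[OF 2[of a] 2[of b]]
      mult_nonneg_nonneg[of "2 ^ bit_size a - 2" "2 ^ bit_size b - (2::int)"] 2[of a] 2[of b]
    by (simp add: algebra_simps)
  finally show ?thesis
    using bit_size_ge1[of a] by (subst bit_size_le_iff) (auto simp: power_add)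
qed

lemma abs_div_le: "\<bar>a div b\<bar> \<le> \<bar>a :: int\<bar>"
proof (cases "b = 0")
  case False
  show ?thesis
  proof (cases "a = 0")
    case False
    have *: "\<bar>x div y\<bar> \<le> \<bar>x\<bar>" if "y > 0" for x y :: int
    proof (cases "x \<ge> 0")
      case True
      then have "0 \<le> x div y" "x div y \<le> x"
        using that zdiv_mono2[of x 1 y] by (simp_all add: pos_imp_zdiv_nonneg_iff)
      then show ?thesis using True by simp
    next
      case False
      then have "x * y \<le> x" using that by (simp add: mult_le_cancel_left)
      then have "x \<le> x div y" using that by (metis zdiv_mono1 nonzero_mult_div_cancel_right less_irrefl)
      moreover have "x div y \<le> 0" using False that by (simp add: div_nonpos_pos_le0)
      ultimately show ?thesis by simp
    qed
    \<comment> \<open>A negative divisor becomes positive by changing both signs.\<close>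
    show ?thesis using *[of b a] *[of "-b" "-a"] \<open>b \<noteq> 0\<close> by (cases "b > 0") auto
  qed simp
qed simp

section \<open>Size and time of expressions in terms of their nodes\<close>

fun expr_nodes :: "expr \<Rightarrow> nat" where
  "expr_nodes (Const c) = 1"
| "expr_nodes (Load a) = expr_nodes a + 1"
| "expr_nodes (Add a b) = expr_nodes a + expr_nodes b + 1"
| "expr_nodes (Sub a b) = expr_nodes a + expr_nodes b + 1"
| "expr_nodes (Mul a b) = expr_nodes a + expr_nodes b + 1"
| "expr_nodes (Div a b) = expr_nodes a + expr_nodes b + 1"

fun expr_bits :: "expr \<Rightarrow> nat" where
  "expr_bits (Const c) = bit_size c"
| "expr_bits (Load a) = expr_bits a"
| "expr_bits (Add a b) = max (expr_bits a) (expr_bits b)"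
| "expr_bits (Sub a b) = max (expr_bits a) (expr_bits b)"
| "expr_bits (Mul a b) = max (expr_bits a) (expr_bits b)"
| "expr_bits (Div a b) = max (expr_bits a) (expr_bits b)"

fun com_bits :: "com \<Rightarrow> nat" where
  "com_bits Skip = 1"
| "com_bits (Store a e) = max (expr_bits a) (expr_bits e)"
| "com_bits (Seq c1 c2) = max (com_bits c1) (com_bits c2)"
| "com_bits (Cond e c1 c2) = max (expr_bits e) (max (com_bits c1) (com_bits c2))"
| "com_bits (While e c) = max (expr_bits e) (com_bits c)"

definition mem_bits_le :: "mem \<Rightarrow> nat \<Rightarrow> bool" where
  "mem_bits_le m W \<longleftrightarrow> (\<forall>a. bit_size (m a) \<le> W)"

lemma mem_bits_leD: "mem_bits_le m W \<Longrightarrow> bit_size (m a) \<le> W"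
  by (simp add: mem_bits_le_def)

lemma mem_bits_le_mono: "mem_bits_le m W \<Longrightarrow> W \<le> W' \<Longrightarrow> mem_bits_le m W'"
  using order_trans by (auto simp: mem_bits_le_def)

lemma mem_bits_le_upd: "mem_bits_le m W \<Longrightarrow> bit_size x \<le> W \<Longrightarrow> mem_bits_le (m(a := x)) W"
  by (auto simp: mem_bits_le_def)

lemma mem_bits_le_pos: "mem_bits_le m W \<Longrightarrow> 1 \<le> W"
  using bit_size_ge1 order_trans mem_bits_leD by blast

lemma expr_nodes_pos: "1 \<le> expr_nodes e"
  by (induction e) auto

text \<open>Every operation at most adds the sizes of its operands, and a load starts again from the
  bound \<open>W\<close> of the registers, so each node contributes at most
  \<open>W\<close>.\<close>

lemma expr_val_bits:
  assumes "mem_bits_le m W"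
  shows "expr_bits e \<le> W \<Longrightarrow> bit_size (expr_val e m) \<le> expr_nodes e * W"
proof (induction e)
  case (Load e)
  then show ?case using mem_bits_leD[OF assms] by (simp add: trans_le_add1)
next
  case (Add e1 e2)
  then show ?case using bit_size_add_abs[of "expr_val e1 m + expr_val e2 m" "expr_val e1 m" "expr_val e2 m"]
    by (simp add: algebra_simps abs_triangle_ineq)
next
  case (Sub e1 e2)
  then show ?case using bit_size_add_abs[of "expr_val e1 m - expr_val e2 m" "expr_val e1 m" "expr_val e2 m"]
    by (simp add: algebra_simps abs_triangle_ineq4)
next
  case (Mul e1 e2)
  then show ?case using bit_size_mult[of "expr_val e1 m" "expr_val e2 m"] by (simp add: algebra_simps)
next
  case (Div e1 e2)
  then show ?case
    using bit_size_mono[OF abs_div_le, of "expr_val e1 m" "expr_val e2 m"] by (simp add: algebra_simps)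
qed auto

lemma two_square_bound: "2 * x ^ 2 + 2 * y ^ 2 + x + y \<le> 3 * (x + y :: nat) ^ 2"
proof -
  have "3 * (x + y) ^ 2 = 2 * x ^ 2 + 2 * y ^ 2 + x * x + y * y + 6 * (x * y)"
    by (simp add: power2_eq_square algebra_simps)
  then show ?thesis using le_square[of x] le_square[of y] by linarith
qed

text \<open>The summand \<open>W\<close> stands for the operator node. In the expanded square its
  cross terms pay for the linear charges, and \<open>x * y\<close> pays for the schoolbook
  product.\<close>

lemma binop_time_bound:
  fixes x y W :: nat
  assumes "tx \<le> 2 * x ^ 2" "ty \<le> 2 * y ^ 2" "u \<le> x" "v \<le> y" "1 \<le> W"
  shows "tx + ty + u + v \<le> 2 * (x + y + W) ^ 2" "tx + ty + u * v \<le> 2 * (x + y + W) ^ 2"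
proof -
  have sq: "2 * (x + y + W) ^ 2
      = 2 * x ^ 2 + 2 * y ^ 2 + 2 * W ^ 2 + 4 * (x * y) + 4 * (x * W) + 4 * (y * W)"
    by (simp add: power2_eq_square algebra_simps)
  have "x \<le> x * W" "y \<le> y * W" using assms(5) by auto
  then show "tx + ty + u + v \<le> 2 * (x + y + W) ^ 2"
    using assms(1-4) sq by linarith
  have "u * v \<le> x * y" using assms by (intro mult_le_mono)
  then show "tx + ty + u * v \<le> 2 * (x + y + W) ^ 2"
    using assms(1,2) sq by linarith
qed

lemma expr_time_bound:
  assumes "mem_bits_le m W"
  shows "expr_bits e \<le> W \<Longrightarrow> expr_time e m \<le> 2 * (expr_nodes e * W) ^ 2"
proof (induction e)
  case (Const c)
  have "W \<le> 2 * W ^ 2" using le_square[of W] unfolding power2_eq_square by linarith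
  with Const show ?case by simp
next
  case (Load e)
  let ?x = "expr_nodes e * W"
  have "bit_size (expr_val e m) \<le> ?x" "bit_size (m (expr_val e m)) \<le> W"
    using expr_val_bits[OF assms, of e] mem_bits_leD[OF assms] Load.prems by auto
  then have "expr_time (Load e) m \<le> 2 * ?x ^ 2 + ?x + W" using Load by simp
  also have "\<dots> \<le> 2 * (?x + W) ^ 2"
  proof -
    have "?x \<le> ?x * W" "W \<le> W * W" using mem_bits_le_pos[OF assms] by auto
    moreover have "2 * (?x + W) ^ 2 = 2 * ?x ^ 2 + 4 * (?x * W) + 2 * (W * W)"
      by (simp add: power2_eq_square algebra_simps)
    ultimately show ?thesis by linarith
  qed
  finally show ?case by (simp add: algebra_simps)
next
  case (Add e1 e2)
  then have "expr_bits e1 \<le> W" "expr_bits e2 \<le> W" by auto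
  from binop_time_bound(1)[OF Add.IH(1)[OF this(1)] Add.IH(2)[OF this(2)]
      expr_val_bits[OF assms this(1)] expr_val_bits[OF assms this(2)] mem_bits_le_pos[OF assms]]
  show ?case by (simp add: algebra_simps)
next
  case (Sub e1 e2)
  then have "expr_bits e1 \<le> W" "expr_bits e2 \<le> W" by auto
  from binop_time_bound(1)[OF Sub.IH(1)[OF this(1)] Sub.IH(2)[OF this(2)]
      expr_val_bits[OF assms this(1)] expr_val_bits[OF assms this(2)] mem_bits_le_pos[OF assms]]
  show ?case by (simp add: algebra_simps)
next
  case (Mul e1 e2)
  then have "expr_bits e1 \<le> W" "expr_bits e2 \<le> W" by auto
  from binop_time_bound(2)[OF Mul.IH(1)[OF this(1)] Mul.IH(2)[OF this(2)]
      expr_val_bits[OF assms this(1)] expr_val_bits[OF assms this(2)] mem_bits_le_pos[OF assms]]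
  show ?case by (simp add: algebra_simps)
next
  case (Div e1 e2)
  then have "expr_bits e1 \<le> W" "expr_bits e2 \<le> W" by auto
  from binop_time_bound(2)[OF Div.IH(1)[OF this(1)] Div.IH(2)[OF this(2)]
      expr_val_bits[OF assms this(1)] expr_val_bits[OF assms this(2)] mem_bits_le_pos[OF assms]]
  show ?case by (simp add: algebra_simps)
qed

section \<open>Unit cost versus logarithmic cost\<close>

text \<open>Companion of \<open>exec\<close> whose price is the number of expression nodes.
  \<open>Weaken\<close> makes the count an upper bound, so that programs can be given convenient
  round numbers.\<close>

inductive run :: "com \<Rightarrow> mem \<Rightarrow> nat \<Rightarrow> mem \<Rightarrow> bool" where
  Skip: "run Skip m 1 m"
| Store: "run (Store a e) m (expr_nodes a + expr_nodes e) (m(expr_val a m := expr_val e m))"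
| Seq: "run c1 m s1 m1 \<Longrightarrow> run c2 m1 s2 m2 \<Longrightarrow> run (Seq c1 c2) m (s1 + s2) m2"
| Cond_true: "expr_val e m > 0 \<Longrightarrow> run c1 m s m1 \<Longrightarrow> run (Cond e c1 c2) m (expr_nodes e + s) m1"
| Cond_false: "expr_val e m \<le> 0 \<Longrightarrow> run c2 m s m1 \<Longrightarrow> run (Cond e c1 c2) m (expr_nodes e + s) m1"
| While_true: "expr_val e m > 0 \<Longrightarrow> run c m s1 m1 \<Longrightarrow> run (While e c) m1 s2 m2 \<Longrightarrow>
     run (While e c) m (expr_nodes e + (s1 + s2)) m2"
| While_false: "expr_val e m \<le> 0 \<Longrightarrow> run (While e c) m (expr_nodes e) m"
| Weaken: "run c m s m1 \<Longrightarrow> s \<le> s' \<Longrightarrow> run c m s' m1"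

lemma run_pos: "run c m s m' \<Longrightarrow> 1 \<le> s"
  by (induction rule: run.induct) (use expr_nodes_pos in \<open>auto simp: trans_le_add1\<close>)

text \<open>A second phase meets registers enlarged by \<open>2 ^ a\<close>, so its quadratic cost
  grows by \<open>4 ^ a\<close>. Base 16 leaves room for both phases: they take at most 1/16 and 1/4
  of the right hand side.\<close>

lemma pow_sum_bound:
  assumes "1 \<le> a" "1 \<le> (b::nat)"
  shows "16 ^ a + 16 ^ b * 4 ^ a \<le> (16::nat) ^ (a + b)"
proof -
  have 1: "16 ^ a * 16 \<le> (16::nat) ^ a * 16 ^ b"
    using power_increasing[OF assms(2), of "16::nat"] by simp
  have "4 ^ a * 4 \<le> (4::nat) ^ a * 4 ^ a"
    using power_increasing[OF assms(1), of "4::nat"] by simp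
  then have "4 ^ a * 4 \<le> (16::nat) ^ a" by (simp flip: power_mult_distrib)
  then have "16 ^ b * (4 ^ a * 4) \<le> 16 ^ b * (16::nat) ^ a" by (rule mult_le_mono2)
  then have "4 * (16 ^ b * 4 ^ a) \<le> (16::nat) ^ a * 16 ^ b" by (simp add: mult_ac)
  with 1 show ?thesis unfolding power_add by linarith
qed

lemma square_two_power: "(2 ^ n) ^ 2 = (4::nat) ^ n"
  using power_mult[of "2::nat" n 2] power_mult[of "2::nat" 2 n] by (simp add: mult.commute)

lemma sq_bound: "3 * n ^ 2 \<le> (16::nat) ^ n"
proof (cases "n = 0")
  case False
  have "n \<le> 2 ^ n" using less_exp by (rule less_imp_le)
  then have "n ^ 2 \<le> (2 ^ n) ^ 2" by (rule power_mono) simp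
  also have "\<dots> = 4 ^ n" by (rule square_two_power)
  finally have "4 * n ^ 2 \<le> 4 ^ n * 4 ^ n"
    using power_increasing[of 1 n "4::nat"] False by (intro mult_mono) auto
  then show ?thesis by (simp flip: power_mult_distrib)
qed simp

text \<open>The invariant that composes: time quadratic in the initial size bound \<open>W\<close>,
  together with a size bound for the memory left to the next phase.\<close>

definition timed :: "com \<Rightarrow> mem \<Rightarrow> nat \<Rightarrow> nat \<Rightarrow> mem \<Rightarrow> bool" where
  "timed c m s W m' \<longleftrightarrow> (\<exists>T. exec c m T m' \<and> T \<le> 16 ^ s * W ^ 2) \<and> mem_bits_le m' (2 ^ s * W)"

lemma seq_bounds:
  assumes "1 \<le> s1" "1 \<le> s2" "T1 \<le> 16 ^ s1 * W ^ 2" "T2 \<le> 16 ^ s2 * (2 ^ s1 * W) ^ 2"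
  shows "T1 + T2 \<le> 16 ^ (s1 + s2) * (W :: nat) ^ 2"
proof -
  have "(2 ^ s1 * W) ^ 2 = 4 ^ s1 * W ^ 2"
    by (simp add: power_mult_distrib square_two_power)
  then have "T1 + T2 \<le> (16 ^ s1 + 16 ^ s2 * 4 ^ s1) * W ^ 2"
    using assms(3,4) by (simp only: distrib_right mult.assoc)
  also have "\<dots> \<le> 16 ^ (s1 + s2) * W ^ 2"
    using pow_sum_bound[OF assms(1,2)] by (rule mult_le_mono1)
  finally show ?thesis .
qed

lemma guard_bound:
  assumes "mem_bits_le m W" "expr_bits e \<le> W"
  shows "expr_time e m + bit_size (expr_val e m) \<le> 16 ^ expr_nodes e * W ^ 2"
proof -
  let ?x = "expr_nodes e * W"
  have "expr_time e m + bit_size (expr_val e m) \<le> 2 * ?x ^ 2 + ?x"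
    using expr_val_bits[OF assms] expr_time_bound[OF assms] by simp
  also have "\<dots> \<le> (3 * (expr_nodes e) ^ 2) * W ^ 2"
    using le_square[of ?x] by (simp add: power2_eq_square algebra_simps del: le_square)
  also have "\<dots> \<le> 16 ^ expr_nodes e * W ^ 2"
    using sq_bound by (rule mult_le_mono1)
  finally show ?thesis .
qed

text \<open>A unit step at most adds up the sizes of its operands. Hence \<open>s\<close> steps blow up the size
  of the registers, and so the time, by a factor that depends only on \<open>s\<close>.\<close>

lemma run_timed: "run c m s m' \<Longrightarrow> mem_bits_le m W \<Longrightarrow> com_bits c \<le> W \<Longrightarrow> timed c m s W m'"
proof (induction arbitrary: W rule: run.induct)
  case (Skip m)
  have "W \<noteq> 0" using mem_bits_le_pos[OF Skip(1)] by simp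
  then show ?case using Skip exec.Skip[of m]
    by (auto simp: timed_def intro!: exI[of _ 1] mem_bits_le_mono[OF Skip(1)])
next
  case (Store a e m)
  let ?x = "expr_nodes a * W" and ?y = "expr_nodes e * W" and ?s = "expr_nodes a + expr_nodes e"
  have b: "bit_size (expr_val a m) \<le> ?x" "bit_size (expr_val e m) \<le> ?y"
    using expr_val_bits[OF Store(1)] Store(2) by auto
  have "expr_time a m + expr_time e m + bit_size (expr_val a m) + bit_size (expr_val e m)
      \<le> 2 * ?x ^ 2 + 2 * ?y ^ 2 + ?x + ?y"
    using b expr_time_bound[OF Store(1), of a] expr_time_bound[OF Store(1), of e] Store(2) by simp
  also have "\<dots> \<le> 3 * (?x + ?y) ^ 2"
    using two_square_bound .
  also have "\<dots> = (3 * ?s ^ 2) * W ^ 2" by (simp add: power2_eq_square algebra_simps)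
  also have "\<dots> \<le> 16 ^ ?s * W ^ 2" using sq_bound by (rule mult_le_mono1)
  finally have T: "expr_time a m + expr_time e m + bit_size (expr_val a m) + bit_size (expr_val e m)
    \<le> 16 ^ ?s * W ^ 2" .
  have "expr_nodes e \<le> 2 ^ ?s" using less_exp[of ?s] by linarith
  then have "?y \<le> 2 ^ ?s * W" by (rule mult_le_mono1)
  then have "mem_bits_le (m(expr_val a m := expr_val e m)) (2 ^ ?s * W)"
    using order_trans[OF b(2)] by (intro mem_bits_le_upd mem_bits_le_mono[OF Store(1)]) auto
  with T exec.Store[of a e m] show ?case unfolding timed_def by blast
next
  case (Seq c1 m s1 m1 c2 s2 m2)
  from Seq.IH(1)[OF Seq.prems(1)] Seq.prems(2)
  obtain T1 where 1: "exec c1 m T1 m1" "T1 \<le> 16 ^ s1 * W ^ 2" "mem_bits_le m1 (2 ^ s1 * W)"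
    by (auto simp: timed_def)
  have "com_bits c2 \<le> 2 ^ s1 * W" using Seq.prems(2) by (simp add: trans_le_add2 order_trans[of _ W])
  from Seq.IH(2)[OF 1(3) this]
  obtain T2 where 2: "exec c2 m1 T2 m2" "T2 \<le> 16 ^ s2 * (2 ^ s1 * W) ^ 2"
    "mem_bits_le m2 (2 ^ s2 * (2 ^ s1 * W))" by (auto simp: timed_def)
  have "T1 + T2 \<le> 16 ^ (s1 + s2) * W ^ 2"
    using seq_bounds[OF run_pos[OF Seq.hyps(1)] run_pos[OF Seq.hyps(2)] 1(2) 2(2)] .
  with exec.Seq[OF 1(1) 2(1)] 2(3) show ?case
    by (auto simp: timed_def power_add mult_ac)
next
  case (Cond_true e m c1 s m1 c2)
  then have e: "expr_bits e \<le> W" by simp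
  from Cond_true obtain T where T: "exec c1 m T m1" "T \<le> 16 ^ s * W ^ 2" "mem_bits_le m1 (2 ^ s * W)"
    by (auto simp: timed_def)
  \<comment> \<open>The guard leaves the memory unchanged; the artificial factor
    \<open>2 ^ expr_nodes e\<close> brings the bound into the shape that \<open>seq_bounds\<close>
    composes.\<close>
  have "T \<le> 16 ^ s * (2 ^ expr_nodes e * W) ^ 2"
    using T(2) by (rule order_trans) (intro mult_le_mono2 power_mono, auto)
  then have "expr_time e m + bit_size (expr_val e m) + T \<le> 16 ^ (expr_nodes e + s) * W ^ 2"
    using seq_bounds[OF expr_nodes_pos run_pos[OF Cond_true.hyps(2)] guard_bound[OF Cond_true.prems(1) e]] by blast
  moreover have "mem_bits_le m1 (2 ^ (expr_nodes e + s) * W)"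
    using T(3) by (rule mem_bits_le_mono) (auto intro: mult_le_mono1 power_increasing)
  ultimately show ?case
    using exec.Cond_true[OF Cond_true.hyps(1) T(1)] unfolding timed_def by blast
next
  case (Cond_false e m c2 s m1 c1)
  then have e: "expr_bits e \<le> W" by simp
  from Cond_false obtain T where T: "exec c2 m T m1" "T \<le> 16 ^ s * W ^ 2" "mem_bits_le m1 (2 ^ s * W)"
    by (auto simp: timed_def)
  have "T \<le> 16 ^ s * (2 ^ expr_nodes e * W) ^ 2"
    using T(2) by (rule order_trans) (intro mult_le_mono2 power_mono, auto)
  then have "expr_time e m + bit_size (expr_val e m) + T \<le> 16 ^ (expr_nodes e + s) * W ^ 2"
    using seq_bounds[OF expr_nodes_pos run_pos[OF Cond_false.hyps(2)] guard_bound[OF Cond_false.prems(1) e]] by blast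
  moreover have "mem_bits_le m1 (2 ^ (expr_nodes e + s) * W)"
    using T(3) by (rule mem_bits_le_mono) (auto intro: mult_le_mono1 power_increasing)
  ultimately show ?case
    using exec.Cond_false[OF Cond_false.hyps(1) T(1)] unfolding timed_def by blast
next
  case (While_true e m c s1 m1 s2 m2)
  then have e: "expr_bits e \<le> W" and w: "com_bits c \<le> W" by auto
  from While_true.IH(1)[OF While_true.prems(1) w]
  obtain T1 where 1: "exec c m T1 m1" "T1 \<le> 16 ^ s1 * W ^ 2" "mem_bits_le m1 (2 ^ s1 * W)"
    by (auto simp: timed_def)
  have "com_bits (While e c) \<le> 2 ^ s1 * W" using While_true.prems(2) by (rule order_trans) simp
  from While_true.IH(2)[OF 1(3) this]
  obtain T2 where 2: "exec (While e c) m1 T2 m2" "T2 \<le> 16 ^ s2 * (2 ^ s1 * W) ^ 2"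
    "mem_bits_le m2 (2 ^ s2 * (2 ^ s1 * W))" by (auto simp: timed_def)
  have "T1 + T2 \<le> 16 ^ (s1 + s2) * W ^ 2"
    using seq_bounds[OF run_pos[OF While_true.hyps(2)] run_pos[OF While_true.hyps(3)] 1(2) 2(2)] .
  also have "\<dots> \<le> 16 ^ (s1 + s2) * (2 ^ expr_nodes e * W) ^ 2"
    by (intro mult_le_mono2 power_mono) auto
  finally have "expr_time e m + bit_size (expr_val e m) + (T1 + T2)
      \<le> 16 ^ (expr_nodes e + (s1 + s2)) * W ^ 2"
    using run_pos[OF While_true.hyps(2)]
    by (intro seq_bounds[OF expr_nodes_pos _ guard_bound[OF While_true.prems(1) e]]) auto
  moreover have "mem_bits_le m2 (2 ^ (expr_nodes e + (s1 + s2)) * W)"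
    using 2(3) by (rule mem_bits_le_mono) (simp add: power_add)
  ultimately show ?case
    using exec.While_true[OF While_true.hyps(1) 1(1) 2(1)] unfolding timed_def
    by (metis add.assoc)
next
  case (While_false e m c)
  then have "expr_bits e \<le> W" by simp
  from guard_bound[OF While_false.prems(1) this] exec.While_false[OF While_false.hyps]
    mem_bits_le_mono[OF While_false.prems(1), of "2 ^ expr_nodes e * W"]
  show ?case unfolding timed_def by (metis mult_le_mono1 nat_mult_1 one_le_numeral one_le_power)
next
  case (Weaken c m s m1 s')
  have "(16::nat) ^ s * W ^ 2 \<le> 16 ^ s' * W ^ 2" "(2::nat) ^ s * W \<le> 2 ^ s' * W"
    using Weaken.hyps(2) by (auto intro: mult_le_mono1 power_increasing)
  then show ?case using Weaken.IH[OF Weaken.prems] unfolding timed_def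
    by (meson mem_bits_le_mono order_trans)
qed

section \<open>Terms with bounded iteration\<close>

text \<open>Loop indices, loop accumulators and temporaries live at the negative addresses, by residue modulo 3,
  so that the input at the nonnegative ones is never overwritten.\<close>

definition idx_addr :: "nat \<Rightarrow> int" where "idx_addr v = - 3 * int v - 1"
definition acc_addr :: "nat \<Rightarrow> int" where "acc_addr v = - 3 * int v - 2"
definition tmp_addr :: "nat \<Rightarrow> int" where "tmp_addr d = - 3 * int d - 3"

lemma addr_simps [simp]:
  "idx_addr v = idx_addr w \<longleftrightarrow> v = w" "acc_addr v = acc_addr w \<longleftrightarrow> v = w"
  "tmp_addr v = tmp_addr w \<longleftrightarrow> v = w"
  "idx_addr v \<noteq> acc_addr w" "acc_addr w \<noteq> idx_addr v"
  "idx_addr v \<noteq> tmp_addr w" "tmp_addr w \<noteq> idx_addr v"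
  "acc_addr v \<noteq> tmp_addr w" "tmp_addr w \<noteq> acc_addr v"
  unfolding idx_addr_def acc_addr_def tmp_addr_def by presburger+

lemma addr_neg [simp]: "idx_addr v < 0" "acc_addr v < 0" "tmp_addr v < 0"
  by (simp_all add: idx_addr_def acc_addr_def tmp_addr_def)

lemma addr_nonneg_neq:
  assumes "0 \<le> a"
  shows "idx_addr v \<noteq> a" "acc_addr v \<noteq> a" "tmp_addr v \<noteq> a"
  using addr_neg assms by (metis linorder_not_less)+

datatype bop = Plus | Minus | Times | Quot

fun bop_val :: "bop \<Rightarrow> int \<Rightarrow> int \<Rightarrow> int" where
  "bop_val Plus x y = x + y"
| "bop_val Minus x y = x - y"
| "bop_val Times x y = x * y"
| "bop_val Quot x y = x div y"

fun bop_expr :: "bop \<Rightarrow> expr \<Rightarrow> expr \<Rightarrow> expr" where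
  "bop_expr Plus a b = Add a b"
| "bop_expr Minus a b = Sub a b"
| "bop_expr Times a b = Mul a b"
| "bop_expr Quot a b = Div a b"

lemma bop_expr_simps [simp]:
  "expr_val (bop_expr b x y) m = bop_val b (expr_val x m) (expr_val y m)"
  "expr_nodes (bop_expr b x y) = expr_nodes x + expr_nodes y + 1"
  by (cases b; simp)+

text \<open>\<open>Inp e\<close> reads the input register addressed by \<open>e\<close>, and register 0 for a nonpositive address.
  \<open>Iter v n e b\<close> iterates the body \<open>b\<close> for the indices \<open>Idx v = 0, \<dots>, n - 1\<close> on the
  accumulator \<open>Acc v\<close> with initial value \<open>e\<close>.\<close>

datatype tm =
    Cst int
  | Idx nat
  | Acc nat
  | Inp tm
  | Bin bop tm tm
  | Pos tm
  | Iter nat tm tm tm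

primrec val :: "tm \<Rightarrow> mem \<Rightarrow> int" where
  "val (Cst c) m = c"
| "val (Idx v) m = m (idx_addr v)"
| "val (Acc v) m = m (acc_addr v)"
| "val (Inp e) m = m (max 0 (val e m))"
| "val (Bin b e1 e2) m = bop_val b (val e1 m) (val e2 m)"
| "val (Pos e) m = (if val e m > 0 then 1 else 0)"
| "val (Iter v n e b) m =
     rec_nat (val e m) (\<lambda>j x. val b (m(idx_addr v := int j, acc_addr v := x))) (nat (val n m))"

text \<open>The constants are upper bounds for the node counts of the compiled code. The summand for
  round \<open>j\<close> uses the accumulator reached after \<open>j\<close> rounds, since the cost
  of the body may depend on it.\<close>

primrec steps :: "tm \<Rightarrow> mem \<Rightarrow> nat" where
  "steps (Cst c) m = 2"
| "steps (Idx v) m = 3"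
| "steps (Acc v) m = 3"
| "steps (Inp e) m = steps e m + 6"
| "steps (Bin b e1 e2) m = steps e1 m + steps e2 m + 8"
| "steps (Pos e) m = steps e m + 4"
| "steps (Iter v n e b) m = steps n m + steps e m + 40 +
     (\<Sum>j<nat (val n m). 20 + steps b (m(idx_addr v := int j, acc_addr v :=
        rec_nat (val e m) (\<lambda>j x. val b (m(idx_addr v := int j, acc_addr v := x))) j)))"

abbreviation rd :: "int \<Rightarrow> expr" where "rd a \<equiv> Load (Const a)"
abbreviation put :: "int \<Rightarrow> expr \<Rightarrow> com" where "put a e \<equiv> Store (Const a) e"

section \<open>Compilation of terms\<close>

definition iter_body :: "nat \<Rightarrow> nat \<Rightarrow> com \<Rightarrow> com" where
  "iter_body v d c =
     Seq c (Seq (put (acc_addr v) (rd (tmp_addr (d + 4)))) (Seq (put (tmp_addr (d + 4)) (Const 0))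
       (put (idx_addr v) (Add (rd (idx_addr v)) (Const 1)))))"

definition iter_guard :: "nat \<Rightarrow> nat \<Rightarrow> expr" where
  "iter_guard v d = Sub (rd (tmp_addr d)) (rd (idx_addr v))"

text \<open>Temporaries form a stack: the result is left at depth \<open>d\<close> and all deeper
  slots used are set back to 0. An iteration keeps its bound, its initial value and the old index
  and accumulator in four slots, so its body starts at depth \<open>d + 4\<close>.\<close>

primrec compile :: "tm \<Rightarrow> nat \<Rightarrow> com" where
  "compile (Cst c) d = put (tmp_addr d) (Const c)"
| "compile (Idx v) d = put (tmp_addr d) (rd (idx_addr v))"
| "compile (Acc v) d = put (tmp_addr d) (rd (acc_addr v))"
| "compile (Inp e) d = Seq (compile e d) (Cond (rd (tmp_addr d))
     (put (tmp_addr d) (Load (rd (tmp_addr d)))) (put (tmp_addr d) (rd 0)))"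
| "compile (Bin b e1 e2) d = Seq (compile e1 d) (Seq (compile e2 (d + 1))
     (Seq (put (tmp_addr d) (bop_expr b (rd (tmp_addr d)) (rd (tmp_addr (d + 1)))))
       (put (tmp_addr (d + 1)) (Const 0))))"
| "compile (Pos e) d = Seq (compile e d) (Cond (rd (tmp_addr d))
     (put (tmp_addr d) (Const 1)) (put (tmp_addr d) (Const 0)))"
| "compile (Iter v n e b) d =
     Seq (compile n d) (Seq (compile e (d + 1))
       (Seq (put (tmp_addr (d + 2)) (rd (idx_addr v))) (Seq (put (tmp_addr (d + 3)) (rd (acc_addr v)))
       (Seq (put (idx_addr v) (Const 0)) (Seq (put (acc_addr v) (rd (tmp_addr (d + 1))))
       (Seq (While (iter_guard v d) (iter_body v d (compile b (d + 4))))
       (Seq (put (tmp_addr d) (rd (acc_addr v)))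
       (Seq (put (idx_addr v) (rd (tmp_addr (d + 2)))) (Seq (put (acc_addr v) (rd (tmp_addr (d + 3))))
       (Seq (put (tmp_addr (d + 1)) (Const 0)) (Seq (put (tmp_addr (d + 2)) (Const 0))
         (put (tmp_addr (d + 3)) (Const 0)))))))))))))"

text \<open>No term reads a temporary: input addresses are cut off at 0 by \<open>max\<close>, while
  temporaries are negative.\<close>

lemma val_cong: "(\<And>a. \<forall>d. a \<noteq> tmp_addr d \<Longrightarrow> m a = m' a) \<Longrightarrow> val e m = val e m'"
proof (induction e arbitrary: m m')
  case (Inp e)
  have "val e m = val e m'" using Inp.IH Inp.prems by blast
  moreover have "\<forall>d. max 0 (val e m') \<noteq> tmp_addr d"
    using addr_nonneg_neq(3)[of "max 0 (val e m')"] by (metis max.cobounded1)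
  ultimately show ?case using Inp.prems by simp
next
  case (Bin b e1 e2)
  from Bin.IH(1)[OF Bin.prems] Bin.IH(2)[OF Bin.prems] show ?case by simp
next
  case (Pos e)
  from Pos.IH[OF Pos.prems] show ?case by simp
next
  case (Iter v n e b)
  have "val b (m(idx_addr v := j, acc_addr v := x)) = val b (m'(idx_addr v := j, acc_addr v := x))" for j x
    by (rule Iter.IH(3)) (use Iter.prems in auto)
  moreover from Iter.IH(1,2)[OF Iter.prems] have "val n m = val n m'" "val e m = val e m'" by auto
  ultimately show ?case by simp
next
  case (Idx v)
  show ?case using Idx[of "idx_addr v"] by simp
next
  case (Acc v)
  show ?case using Acc[of "acc_addr v"] by simp
qed simp

lemma steps_cong: "(\<And>a. \<forall>d. a \<noteq> tmp_addr d \<Longrightarrow> m a = m' a) \<Longrightarrow> steps e m = steps e m'"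
proof (induction e arbitrary: m m')
  case (Bin b e1 e2)
  from Bin.IH(1)[OF Bin.prems] Bin.IH(2)[OF Bin.prems] show ?case by simp
next
  case (Iter v n e b)
  have "steps b (m(idx_addr v := j, acc_addr v := x)) = steps b (m'(idx_addr v := j, acc_addr v := x))" for j x
    by (rule Iter.IH(3)) (use Iter.prems in auto)
  moreover have "val b (m(idx_addr v := j, acc_addr v := x)) = val b (m'(idx_addr v := j, acc_addr v := x))" for j x
    by (rule val_cong) (use Iter.prems in auto)
  moreover from Iter.IH(1,2)[OF Iter.prems] have "steps n m = steps n m'" "steps e m = steps e m'" by auto
  moreover from val_cong[OF Iter.prems] have "val n m = val n m'" "val e m = val e m'" by auto
  ultimately show ?case by simp
next
  case (Inp e)
  from Inp.IH[OF Inp.prems] show ?case by simp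
next
  case (Pos e)
  from Pos.IH[OF Pos.prems] show ?case by simp
qed simp_all

lemma run_put: "m' = m(a := expr_val e m) \<Longrightarrow> run (put a e) m (1 + expr_nodes e) m'"
  using run.Store[of "Const a" e m] by simp

lemma run_le: "run c m s m1 \<Longrightarrow> s \<le> s' \<Longrightarrow> m1 = m' \<Longrightarrow> run c m s' m'"
  using run.Weaken by blast

definition clean :: "nat \<Rightarrow> mem \<Rightarrow> bool" where
  "clean d m \<longleftrightarrow> (\<forall>d'\<ge>d. m (tmp_addr d') = 0)"

lemma cleanD: "clean d m \<Longrightarrow> d \<le> d' \<Longrightarrow> m (tmp_addr d') = 0"
  by (simp add: clean_def)

text \<open>Since the stack is zero from depth \<open>d\<close> on, clearing the temporaries
  restores them exactly, and the final memory differs from \<open>m\<close> in one register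
  only.\<close>

lemma run_compile:
  "clean d m \<Longrightarrow> run (compile e d) m (steps e m) (m(tmp_addr d := val e m))"
proof (induction e arbitrary: d m)
  case (Cst c)
  show ?case unfolding compile.simps by (rule run_le[OF run_put[OF refl]]) auto
next
  case (Idx v)
  show ?case unfolding compile.simps by (rule run_le[OF run_put[OF refl]]) auto
next
  case (Acc v)
  show ?case unfolding compile.simps by (rule run_le[OF run_put[OF refl]]) auto
next
  case (Inp e)
  let ?m = "m(tmp_addr d := val e m)"
  have "run (Cond (rd (tmp_addr d)) (put (tmp_addr d) (Load (rd (tmp_addr d)))) (put (tmp_addr d) (rd 0)))
     ?m 6 (m(tmp_addr d := m (max 0 (val e m))))"
  proof (cases "val e m > 0")
    case True
    then have "val e m \<noteq> tmp_addr d" using addr_neg(3)[of d] by linarith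
    with True show ?thesis
      by (intro run_le[OF run.Cond_true[OF _ run_put[OF refl]]]) (simp_all add: max_def)
  next
    case False
    moreover have "0 \<noteq> tmp_addr d" using addr_neg(3)[of d] by linarith
    ultimately show ?thesis
      by (intro run_le[OF run.Cond_false[OF _ run_put[OF refl]]]) (simp_all add: max_def)
  qed
  from run.Seq[OF Inp.IH[OF Inp.prems] this] show ?case by (simp only: compile.simps steps.simps val.simps)
next
  case (Bin b e1 e2)
  let ?m = "m(tmp_addr d := val e1 m)"
  have v: "val e2 ?m = val e2 m" and s: "steps e2 ?m = steps e2 m"
    by (rule val_cong steps_cong; force)+
  have "run (compile e2 (d + 1)) ?m (steps e2 ?m) (?m(tmp_addr (d + 1) := val e2 ?m))"
    by (rule Bin.IH(2)) (use Bin.prems in \<open>auto simp: clean_def\<close>)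
  note r = this[unfolded v s]
  show ?case unfolding compile.simps
    by (rule run_le[OF run.Seq[OF Bin.IH(1)[OF Bin.prems]
            run.Seq[OF r run.Seq[OF run_put[OF refl] run_put[OF refl]]]]])
      (use cleanD[OF Bin.prems, of "d + 1"] in \<open>auto simp: fun_eq_iff\<close>)
next
  case (Pos e)
  let ?m = "m(tmp_addr d := val e m)"
  have "run (Cond (rd (tmp_addr d)) (put (tmp_addr d) (Const 1)) (put (tmp_addr d) (Const 0)))
     ?m 4 (m(tmp_addr d := (if val e m > 0 then 1 else 0)))"
  proof (cases "val e m > 0")
    case True
    then show ?thesis by (intro run_le[OF run.Cond_true[OF _ run_put[OF refl]]]) auto
  next
    case False
    then show ?thesis by (intro run_le[OF run.Cond_false[OF _ run_put[OF refl]]]) auto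
  qed
  from run.Seq[OF Pos.IH[OF Pos.prems] this] show ?case by (simp only: compile.simps steps.simps val.simps)
next
  case (Iter v n e b)
  let ?i = "idx_addr v" and ?a = "acc_addr v"
  let ?N = "nat (val n m)" and ?x = "\<lambda>j. rec_nat (val e m) (\<lambda>j x. val b (m(?i := int j, ?a := x))) j"
  let ?e = "\<lambda>j x. m(?i := int j, ?a := x)"
  \<comment> \<open>Memory before round \<open>j\<close>, with the old index and accumulator saved
    on the stack.\<close>
  define M where "M j = m(tmp_addr d := val n m, tmp_addr (d + 1) := val e m,
    tmp_addr (d + 2) := m ?i, tmp_addr (d + 3) := m ?a, ?i := int j, ?a := ?x j)" for j
  let ?W = "While (iter_guard v d) (iter_body v d (compile b (d + 4)))"
  let ?S = "\<lambda>j. 20 + steps b (?e j (?x j))"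
  have guard: "expr_val (iter_guard v d) (M j) = val n m - int j" "expr_nodes (iter_guard v d) = 5" for j
    by (auto simp: iter_guard_def M_def)
  have body: "run (iter_body v d (compile b (d + 4))) (M j) (steps b (?e j (?x j)) + 10) (M (Suc j))" for j
  proof -
    have v: "val b (M j) = val b (?e j (?x j))" and s: "steps b (M j) = steps b (?e j (?x j))"
      by (rule val_cong steps_cong; force simp: M_def)+
    have "run (compile b (d + 4)) (M j) (steps b (M j)) ((M j)(tmp_addr (d + 4) := val b (M j)))"
      by (rule Iter.IH(3)) (use Iter.prems in \<open>auto simp: M_def clean_def\<close>)
    note r = this[unfolded v s]
    show ?thesis unfolding iter_body_def
      by (rule run_le[OF run.Seq[OF r run.Seq[OF run_put[OF refl] run.Seq[OF run_put[OF refl] run_put[OF refl]]]]])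
        (use cleanD[OF Iter.prems, of "d + 4"] in \<open>auto simp: fun_eq_iff M_def\<close>)
  qed
  \<comment> \<open>Induction on the number \<open>k\<close> of rounds left, since a loop unrolls at
    its first round.\<close>
  have "run ?W (M (?N - k)) (5 + (\<Sum>j=?N - k..<?N. ?S j)) (M ?N)" if "k \<le> ?N" for k
    using that
  proof (induction k)
    case 0
    have "expr_val (iter_guard v d) (M ?N) \<le> 0" by (simp add: guard)
    from run.While_false[OF this] show ?case by (simp add: guard)
  next
    case (Suc k)
    then have *: "Suc (?N - Suc k) = ?N - k" by simp
    have "expr_val (iter_guard v d) (M (?N - Suc k)) > 0"
      using Suc.prems unfolding guard(1) by linarith
    note g = this
    have "run ?W (M (Suc (?N - Suc k))) (5 + (\<Sum>j=?N - k..<?N. ?S j)) (M ?N)"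
      unfolding * using Suc.prems by (intro Suc.IH) simp
    note r = run.While_true[OF g body this, unfolded guard(2)]
    have "(\<Sum>j=?N - Suc k..<?N. ?S j) = ?S (?N - Suc k) + (\<Sum>j=?N - k..<?N. ?S j)"
      using Suc.prems unfolding *[symmetric] by (intro sum.atLeast_Suc_lessThan) linarith
    then show ?case by (intro run_le[OF r _ refl]) linarith
  qed
  from this[of ?N] have W: "run ?W (M 0) (5 + (\<Sum>j<?N. ?S j)) (M ?N)"
    by (simp add: atLeast0LessThan)
  let ?m = "m(tmp_addr d := val n m)"
  have v: "val e ?m = val e m" and s: "steps e ?m = steps e m"
    by (rule val_cong steps_cong; force)+
  have "run (compile e (d + 1)) ?m (steps e ?m) (?m(tmp_addr (d + 1) := val e ?m))"
    by (rule Iter.IH(2)) (use Iter.prems in \<open>auto simp: clean_def\<close>)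
  note r = this[unfolded v s]
  have z: "m (tmp_addr (d + j)) = 0" for j using cleanD[OF Iter.prems, of "d + j"] by simp
  define m2 where "m2 = m(tmp_addr d := val n m, tmp_addr (d + 1) := val e m)"
  define m4 where "m4 = m2(tmp_addr (d + 2) := m ?i, tmp_addr (d + 3) := m ?a)"
  have before: "run (put (tmp_addr (d + 2)) (rd ?i)) m2 3 (m2(tmp_addr (d + 2) := m ?i))"
    "run (put (tmp_addr (d + 3)) (rd ?a)) (m2(tmp_addr (d + 2) := m ?i)) 3 m4"
    "run (put ?i (Const 0)) m4 2 (m4(?i := 0))"
    "run (put ?a (rd (tmp_addr (d + 1)))) (m4(?i := 0)) 3 (M 0)"
    by (rule run_le[OF run_put[OF refl]]; simp add: m2_def m4_def M_def)+
  define x where "x = val (Iter v n e b) m"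
  have x: "?x ?N = x" by (simp add: x_def)
  define n1 where "n1 = (M ?N)(tmp_addr d := x)"
  define n3 where "n3 = n1(?i := m ?i, ?a := m ?a)"
  have after: "run (put (tmp_addr d) (rd ?a)) (M ?N) 3 n1"
    "run (put ?i (rd (tmp_addr (d + 2)))) n1 3 (n1(?i := m ?i))"
    "run (put ?a (rd (tmp_addr (d + 3)))) (n1(?i := m ?i)) 3 n3"
    "run (put (tmp_addr (d + 1)) (Const 0)) n3 2 (n3(tmp_addr (d + 1) := 0))"
    "run (put (tmp_addr (d + 2)) (Const 0)) (n3(tmp_addr (d + 1) := 0)) 2
      (n3(tmp_addr (d + 1) := 0, tmp_addr (d + 2) := 0))"
    by (rule run_le[OF run_put[OF refl]]; simp add: n1_def n3_def M_def x del: fun_upd_apply; simp)+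
  have last: "n3(tmp_addr (d + 1) := 0, tmp_addr (d + 2) := 0, tmp_addr (d + 3) := 0)
      = m(tmp_addr d := x)"
    using z[of 1] z[of 2] z[of 3] by (auto simp: fun_eq_iff n1_def n3_def M_def)
  have last: "run (put (tmp_addr (d + 3)) (Const 0)) (n3(tmp_addr (d + 1) := 0, tmp_addr (d + 2) := 0)) 2
      (m(tmp_addr d := x))"
    by (rule run_le[OF run_put[OF refl]]) (simp_all only: last expr_nodes.simps expr_val.simps)
  have init: "run (compile n d) m (steps n m) (m(tmp_addr d := val n m))"
    by (rule Iter.IH(1)[OF Iter.prems])
  show ?case unfolding compile.simps x_def[symmetric]
    by (rule run_le[OF run.Seq[OF init run.Seq[OF r[folded m2_def] run.Seq[OF before(1) run.Seq[OF before(2)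
      run.Seq[OF before(3) run.Seq[OF before(4) run.Seq[OF W run.Seq[OF after(1) run.Seq[OF after(2)
      run.Seq[OF after(3) run.Seq[OF after(4) run.Seq[OF after(5) last]]]]]]]]]]]] _ refl])
     (simp del: fun_upd_apply)
qed

text \<open>Registers 0 and 1 hold the parameters \<open>t\<close> and \<open>k\<close>. Iteration counts that depend only on these make
  the number of steps a function of the parameters.\<close>

primrec static :: "int set \<Rightarrow> tm \<Rightarrow> bool" where
  "static V (Cst c) \<longleftrightarrow> True"
| "static V (Idx v) \<longleftrightarrow> idx_addr v \<in> V"
| "static V (Acc v) \<longleftrightarrow> acc_addr v \<in> V"
| "static V (Inp e) \<longleftrightarrow> e = Cst 0 \<or> e = Cst 1"
| "static V (Bin b e1 e2) \<longleftrightarrow> static V e1 \<and> static V e2"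
| "static V (Pos e) \<longleftrightarrow> static V e"
| "static V (Iter v n e b) \<longleftrightarrow>
     static V n \<and> static V e \<and> static (insert (acc_addr v) (insert (idx_addr v) V)) b"

text \<open>\<open>V\<close> collects registers on which two memories agree. A loop index joins it,
  as both runs count alike; the accumulator leaves it, as it may carry input data. In
  \<open>static\<close> both join, because there the accumulator is computed from agreeing
  values.\<close>

primrec oblivious :: "int set \<Rightarrow> tm \<Rightarrow> bool" where
  "oblivious V (Cst c) \<longleftrightarrow> True"
| "oblivious V (Idx v) \<longleftrightarrow> True"
| "oblivious V (Acc v) \<longleftrightarrow> True"
| "oblivious V (Inp e) \<longleftrightarrow> oblivious V e"
| "oblivious V (Bin b e1 e2) \<longleftrightarrow> oblivious V e1 \<and> oblivious V e2"
| "oblivious V (Pos e) \<longleftrightarrow> oblivious V e"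
| "oblivious V (Iter v n e b) \<longleftrightarrow> static V n \<and> oblivious V n \<and> oblivious V e \<and>
     oblivious (insert (idx_addr v) (V - {acc_addr v})) b"

definition agree :: "int set \<Rightarrow> mem \<Rightarrow> mem \<Rightarrow> bool" where
  "agree V m m' \<longleftrightarrow> m 0 = m' 0 \<and> m 1 = m' 1 \<and> (\<forall>a\<in>V. m a = m' a)"

lemma agree_upd: "agree V m m' \<Longrightarrow> agree (insert a V) (m(a := x)) (m'(a := x))"
  by (auto simp: agree_def)

lemma val_static: "static V e \<Longrightarrow> agree V m m' \<Longrightarrow> val e m = val e m'"
proof (induction e arbitrary: V m m')
  case (Iter v n e b)
  have "val b (m(idx_addr v := j, acc_addr v := x)) = val b (m'(idx_addr v := j, acc_addr v := x))" for j x
    by (rule Iter.IH(3)[OF _ agree_upd[OF agree_upd[OF Iter.prems(2)]]]) (use Iter.prems in simp)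
  moreover have "val n m = val n m'" "val e m = val e m'"
    using Iter.IH(1,2)[OF _ Iter.prems(2)] Iter.prems(1) by auto
  ultimately show ?case by simp
next
  case (Bin b e1 e2)
  from Bin.prems(1) have "static V e1" "static V e2" by auto
  then have "val e1 m = val e1 m'" "val e2 m = val e2 m'"
    using Bin.IH(1)[OF _ Bin.prems(2)] Bin.IH(2)[OF _ Bin.prems(2)] by blast+
  then show ?case by simp
next
  case (Pos e)
  from Pos.prems(1) have "static V e" by simp
  then have "val e m = val e m'" by (rule Pos.IH[OF _ Pos.prems(2)])
  then show ?case by simp
qed (auto simp: agree_def)

lemma steps_oblivious: "oblivious V e \<Longrightarrow> agree V m m' \<Longrightarrow> steps e m = steps e m'"
proof (induction e arbitrary: V m m')
  case (Iter v n e b)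
  have "steps b (m(idx_addr v := j, acc_addr v := x)) = steps b (m'(idx_addr v := j, acc_addr v := x'))" for j x x'
    by (rule Iter.IH(3)[of "insert (idx_addr v) (V - {acc_addr v})"])
      (use Iter.prems in \<open>auto simp: agree_def addr_nonneg_neq\<close>)
  then have "(\<Sum>j<nat (val n m). 20 + steps b (m(idx_addr v := int j, acc_addr v := F j)))
    = (\<Sum>j<nat (val n m). 20 + steps b (m'(idx_addr v := int j, acc_addr v := G j)))" for F G
    by (intro sum.cong refl arg_cong[where f = "(+) 20"])
  moreover have e: "steps n m = steps n m'" "steps e m = steps e m'" "val n m = val n m'"
    using Iter.IH(1,2)[OF _ Iter.prems(2)] val_static[OF _ Iter.prems(2)] Iter.prems(1) by auto
  ultimately show ?case
    unfolding steps.simps e(1,2) e(3)[symmetric] by (intro arg_cong2[where f = "(+)"] refl)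
next
  case (Inp e)
  from Inp.prems(1) have "oblivious V e" by simp
  then have "steps e m = steps e m'" by (rule Inp.IH[OF _ Inp.prems(2)])
  then show ?case by simp
next
  case (Bin b e1 e2)
  from Bin.prems(1) have "oblivious V e1" "oblivious V e2" by auto
  then have "steps e1 m = steps e1 m'" "steps e2 m = steps e2 m'"
    using Bin.IH(1)[OF _ Bin.prems(2)] Bin.IH(2)[OF _ Bin.prems(2)] by blast+
  then show ?case by simp
next
  case (Pos e)
  from Pos.prems(1) have "oblivious V e" by simp
  then have "steps e m = steps e m'" by (rule Pos.IH[OF _ Pos.prems(2)])
  then show ?case by simp
qed auto

section \<open>Edge types\<close>

text \<open>Vectors are numbers throughout, so that a counting loop can range over them: edge types
  in base \<open>t + 1\<close>, carries in base \<open>B\<close>, sets of states and choices of bits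
  in base 2.\<close>

definition digit :: "nat \<Rightarrow> nat \<Rightarrow> nat \<Rightarrow> nat" where
  "digit b l i = l div b ^ i mod b"

definition from_digits :: "nat \<Rightarrow> (nat \<Rightarrow> nat) \<Rightarrow> nat \<Rightarrow> nat" where
  "from_digits b c m = (\<Sum>i<m. c i * b ^ i)"

lemma digit_less: "0 < b \<Longrightarrow> digit b l i < b"
  by (simp add: digit_def)

lemma from_digits_less: "(\<And>i. i < m \<Longrightarrow> c i < b) \<Longrightarrow> from_digits b c m < b ^ m"
proof (induction m)
  case (Suc m)
  then have "from_digits b c m < b ^ m" "c m * b ^ m + b ^ m \<le> b * b ^ m"
    using mult_le_mono1[of "c m + 1" b "b ^ m"] by (auto simp: Suc_le_eq)
  then show ?case by (simp add: from_digits_def)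
qed (simp add: from_digits_def)

lemma digit_from_digits:
  "(\<And>i. i < m \<Longrightarrow> c i < b) \<Longrightarrow> i < m \<Longrightarrow> digit b (from_digits b c m) i = c i"
proof (induction m arbitrary: i)
  case (Suc m)
  have l: "from_digits b c m < b ^ m" using Suc.prems(1) by (intro from_digits_less) auto
  have b: "0 < b" using Suc.prems(1)[of 0] by simp
  have eq: "from_digits b c (Suc m) = from_digits b c m + c m * b ^ m"
    by (simp add: from_digits_def)
  show ?case
  proof (cases "i = m")
    case True
    then show ?thesis using l b Suc.prems(1)[of m] by (simp add: digit_def eq)
  next
    case False
    with Suc.prems have "i < m" by simp
    then have "b ^ m = b ^ i * (b * b ^ (m - Suc i))" by (simp flip: power_add power_Suc)
    then have "from_digits b c (Suc m) = from_digits b c m + b ^ i * (b * (c m * b ^ (m - Suc i)))"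
      by (simp add: eq mult_ac)
    then have "from_digits b c (Suc m) div b ^ i = from_digits b c m div b ^ i + b * (c m * b ^ (m - Suc i))"
      using b by simp
    then show ?thesis using Suc.IH[OF _ \<open>i < m\<close>] Suc.prems(1) by (simp add: digit_def)
  qed
qed simp

lemma from_digits_digit: "0 < b \<Longrightarrow> from_digits b (digit b l) m = l mod b ^ m"
proof (induction m)
  case (Suc m)
  have "from_digits b (digit b l) (Suc m) = l mod b ^ m + (l div b ^ m mod b) * b ^ m"
    using Suc by (simp add: from_digits_def digit_def)
  also have "\<dots> = l mod (b ^ m * b)" using mod_mult2_eq[of l "b ^ m" b] by (simp add: mult.commute)
  finally show ?case by (simp add: mult.commute)
qed (simp add: from_digits_def)

section \<open>Exchanging vertices in edges\<close>

lemma degree_in_swap: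
  assumes "finite E" "e \<in> E" "v \<in> e" "w \<notin> e" "insert w (e - {v}) \<notin> E"
  defines "E' \<equiv> insert (insert w (e - {v})) (E - {e})"
  shows "degree_in E v = Suc (degree_in E' v)" "degree_in E' w = Suc (degree_in E w)"
    "u \<noteq> v \<Longrightarrow> u \<noteq> w \<Longrightarrow> degree_in E' u = degree_in E u"
proof -
  let ?e = "insert w (e - {v})"
  have "v \<noteq> w" using assms by auto
  have "{f \<in> E. v \<in> f} = insert e {f \<in> E'. v \<in> f}" "e \<notin> {f \<in> E'. v \<in> f}"
    using assms \<open>v \<noteq> w\<close> by auto
  then show "degree_in E v = Suc (degree_in E' v)"
    using assms(1) by (simp add: degree_in_def E'_def)
  have "{f \<in> E'. w \<in> f} = insert ?e {f \<in> E. w \<in> f}" "?e \<notin> {f \<in> E. w \<in> f}"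
    using assms by auto
  then show "degree_in E' w = Suc (degree_in E w)"
    using assms(1) by (simp add: degree_in_def)
  assume u: "u \<noteq> v" "u \<noteq> w"
  show "degree_in E' u = degree_in E u"
  proof (cases "u \<in> e")
    case True
    then have "{f \<in> E'. u \<in> f} = insert ?e ({f \<in> E. u \<in> f} - {e})"
      using u by (auto simp: E'_def)
    moreover have "?e \<notin> {f \<in> E. u \<in> f} - {e}" "e \<in> {f \<in> E. u \<in> f}" using assms True by auto
    moreover have fin: "finite {f \<in> E. u \<in> f}" using assms(1) by simp
    ultimately have "card {f \<in> E'. u \<in> f} = Suc (card ({f \<in> E. u \<in> f} - {e}))"
      by (simp only: card_insert_disjoint finite_Diff not_False_eq_True)
    also have "\<dots> = card {f \<in> E. u \<in> f}"
      by (rule card_Suc_Diff1[OF fin]) (use assms(2) True in simp)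
    finally show ?thesis by (simp only: degree_in_def)
  next
    case False
    then have "{f \<in> E'. u \<in> f} = {f \<in> E. u \<in> f}"
      using u by (auto simp: E'_def)
    then show ?thesis by (simp add: degree_in_def)
  qed
qed

text \<open>Otherwise exchanging \<open>v\<close> for \<open>w\<close> would inject the edges
  through \<open>v\<close> but not \<open>w\<close> into those through \<open>w\<close> but not
  \<open>v\<close>. Edges through both count equally, so the degree of \<open>v\<close> could not be
  larger.\<close>

lemma exists_swap:
  assumes "finite E" "degree_in E w < degree_in E v"
  obtains e where "e \<in> E" "v \<in> e" "w \<notin> e" "insert w (e - {v}) \<notin> E"
proof (rule ccontr)
  assume "\<not> thesis"
  with that have *: "insert w (e - {v}) \<in> E" if "e \<in> E" "v \<in> e" "w \<notin> e" for e using \<open>e \<in> E\<close> that by blast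
  have "v \<noteq> w" using assms(2) by auto
  let ?P = "{e \<in> E. v \<in> e \<and> w \<notin> e}" and ?Q = "{e \<in> E. w \<in> e \<and> v \<notin> e}" and ?R = "{e \<in> E. v \<in> e \<and> w \<in> e}"
  have "inj_on (\<lambda>e. insert w (e - {v})) ?P"
    by (rule inj_on_inverseI[where g = "\<lambda>e. insert v (e - {w})"]) auto
  then have "card ?P \<le> card ?Q"
    by (rule card_inj_on_le) (use * assms(1) \<open>v \<noteq> w\<close> in auto)
  moreover have "{e \<in> E. v \<in> e} = ?P \<union> ?R" "{e \<in> E. w \<in> e} = ?Q \<union> ?R" by auto
  then have "degree_in E v = card ?P + card ?R" "degree_in E w = card ?Q + card ?R"
    unfolding degree_in_def using assms(1) by (simp_all add: card_Un_disjoint disjoint_iff)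
  ultimately show False using assms(2) by simp
qed

text \<open>Moving an edge from a vertex of too large degree to one of too small degree in the same class
  keeps the degree sums of the classes and decreases the sum of the squares of the degrees.\<close>

lemma regularize_degrees:
  assumes "finite V" "E \<subseteq> nsets V t"
    and "\<And>i. (\<Sum>v | v \<in> V \<and> cls v = i. degree_in E v) = card {v \<in> V. cls v = i} * d i"
  shows "\<exists>E' \<subseteq> nsets V t. \<forall>v\<in>V. degree_in E' v = d (cls v)"
  using assms(2,3)
proof (induction "\<Sum>v\<in>V. (degree_in E v) ^ 2" arbitrary: E rule: less_induct)
  case less
  show ?case
  proof (cases "\<forall>v\<in>V. degree_in E v = d (cls v)")
    case True
    then show ?thesis using less.prems by auto
  next
    case False
    then obtain v0 where v0: "v0 \<in> V" "degree_in E v0 \<noteq> d (cls v0)" by auto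
    let ?C = "{v \<in> V. cls v = cls v0}"
    have C: "finite ?C" "v0 \<in> ?C" using assms(1) v0 by auto
    have s: "(\<Sum>v\<in>?C. degree_in E v) = (\<Sum>v\<in>?C. d (cls v0))" using less.prems(2) by simp
    \<comment> \<open>The class has the right degree sum but a wrong degree at \<open>v0\<close>, so
      some vertex lies above the target and some below.\<close>
    have "\<exists>v\<in>?C. degree_in E v > d (cls v0)"
    proof (rule ccontr)
      assume "\<not> ?thesis"
      then have le: "\<And>v. v \<in> ?C \<Longrightarrow> degree_in E v \<le> d (cls v0)" by force
      moreover have "degree_in E v0 < d (cls v0)" using le[OF C(2)] v0(2) by simp
      ultimately have "(\<Sum>v\<in>?C. degree_in E v) < (\<Sum>v\<in>?C. d (cls v0))"
        using C by (intro sum_strict_mono_ex1) auto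
      with s show False by simp
    qed
    then obtain v where v: "v \<in> V" "cls v = cls v0" "degree_in E v > d (cls v0)" by auto
    have "\<exists>v\<in>?C. degree_in E v < d (cls v0)"
    proof (rule ccontr)
      assume "\<not> ?thesis"
      then have le: "\<And>v. v \<in> ?C \<Longrightarrow> degree_in E v \<ge> d (cls v0)" by force
      have "(\<Sum>v\<in>?C. degree_in E v) > (\<Sum>v\<in>?C. d (cls v0))"
        using C le v by (intro sum_strict_mono_ex1) auto
      with s show False by simp
    qed
    then obtain w where w: "w \<in> V" "cls w = cls v0" "degree_in E w < d (cls v0)" by auto
    have fE: "finite E" using less.prems(1) finite_imp_finite_nsets[OF assms(1)] finite_subset by blast
    have "degree_in E w < degree_in E v" using v w by simp
    from exists_swap[OF fE this] obtain e where e: "e \<in> E" "v \<in> e" "w \<notin> e" "insert w (e - {v}) \<notin> E" .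
    define E' where "E' = insert (insert w (e - {v})) (E - {e})"
    note sw = degree_in_swap[OF fE e, folded E'_def]
    have vw: "v \<noteq> w" using v w by auto
    have "e \<in> nsets V t" using e less.prems by auto
    moreover from this have "card (insert w (e - {v})) = card e"
      using e(2,3) card_Suc_Diff1[of e v] by (simp add: nsets_def)
    ultimately have "insert w (e - {v}) \<in> nsets V t"
      using w(1) by (auto simp: nsets_def)
    then have E': "E' \<subseteq> nsets V t" using less.prems(1) by (auto simp: E'_def)
    have split: "sum g A = g v + g w + sum g (A - {v, w})"
      if "finite A" "v \<in> A" "w \<in> A" for A and g :: "_ \<Rightarrow> nat"
    proof -
      have "sum g A = g v + sum g (A - {v})" using that by (intro sum.remove)
      also have "sum g (A - {v}) = g w + sum g (A - {v} - {w})" using that vw by (intro sum.remove) auto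
      also have "A - {v} - {w} = A - {v, w}" by auto
      finally show ?thesis by (simp only: add.assoc)
    qed
    have "(\<Sum>v\<in>V. (degree_in E' v) ^ 2) < (\<Sum>v\<in>V. (degree_in E v) ^ 2)"
    proof -
      have "(\<Sum>u\<in>V - {v, w}. (degree_in E' u) ^ 2) = (\<Sum>u\<in>V - {v, w}. (degree_in E u) ^ 2)"
        by (rule sum.cong) (auto simp: sw(3))
      \<comment> \<open>The target lies strictly between the two degrees. They differ by at least 2,
        and moving one unit lowers the sum of squares.\<close>
      moreover have "(degree_in E' v) ^ 2 + (degree_in E' w) ^ 2 < (degree_in E v) ^ 2 + (degree_in E w) ^ 2"
        using sw(1,2) v w by (simp add: power2_eq_square)
      ultimately show ?thesis
        using assms(1) v(1) w(1) by (simp add: split)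
    qed
    moreover have "(\<Sum>v | v \<in> V \<and> cls v = i. degree_in E' v) = card {v \<in> V. cls v = i} * d i" for i
    proof -
      have "(\<Sum>v | v \<in> V \<and> cls v = i. degree_in E' v) = (\<Sum>v | v \<in> V \<and> cls v = i. degree_in E v)"
      proof (cases "i = cls v0")
        case True
        have "(\<Sum>u\<in>?C - {v, w}. degree_in E' u) = (\<Sum>u\<in>?C - {v, w}. degree_in E u)"
          by (rule sum.cong) (auto simp: sw(3))
        then show ?thesis using True C v w sw(1,2) by (simp add: split)
      next
        case False
        then show ?thesis using v w by (intro sum.cong refl sw(3)) auto
      qed
      with less.prems(2) show ?thesis by simp
    qed
    ultimately show ?thesis using less.hyps[OF _ E'] by blast
  qed
qed

section \<open>Counting edges by type\<close>

lemma sum_degrees: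
  assumes "finite E" "finite A"
  shows "(\<Sum>v\<in>A. degree_in E v) = (\<Sum>e\<in>E. card (e \<inter> A))"
proof -
  have "(\<Sum>v\<in>A. degree_in E v) = (\<Sum>v\<in>A. \<Sum>e\<in>E. if v \<in> e then 1 else 0)"
    using assms by (simp add: degree_in_def sum.If_cases Int_def)
  also have "\<dots> = (\<Sum>e\<in>E. \<Sum>v\<in>A. if v \<in> e then 1 else 0)" by (rule sum.swap)
  also have "\<dots> = (\<Sum>e\<in>E. card (e \<inter> A))"
    using assms by (intro sum.cong refl) (simp add: sum.If_cases Int_commute)
  finally show ?thesis .
qed

definition sets_of_type :: "'a set \<Rightarrow> ('a \<Rightarrow> nat) \<Rightarrow> nat \<Rightarrow> (nat \<Rightarrow> nat) \<Rightarrow> 'a set set" where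
  "sets_of_type V cls k a = {e. e \<subseteq> V \<and> (\<forall>i<k. card (e \<inter> {v \<in> V. cls v = i}) = a i)}"

text \<open>A set of vertices is determined by its traces on the classes, which can be chosen
  independently.\<close>

lemma card_sets_of_type:
  assumes "finite V" "\<And>v. v \<in> V \<Longrightarrow> cls v < k"
  shows "card (sets_of_type V cls k a) = (\<Prod>i<k. card {v \<in> V. cls v = i} choose a i)"
proof -
  let ?V = "\<lambda>i. {v \<in> V. cls v = i}"
  let ?P = "\<Pi>\<^sub>E i\<in>{..<k}. {s. s \<subseteq> ?V i \<and> card s = a i}"
  have "bij_betw (\<lambda>e. \<lambda>i\<in>{..<k}. e \<inter> ?V i) (sets_of_type V cls k a) ?P"
  proof (rule bij_betw_byWitness[where f' = "\<lambda>F. \<Union>i<k. F i"])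
    show "\<forall>e\<in>sets_of_type V cls k a. (\<Union>i<k. (\<lambda>i\<in>{..<k}. e \<inter> ?V i) i) = e"
      using assms(2) by (auto simp: sets_of_type_def)
    have *: "(\<Union>j<k. F j) \<inter> ?V i = F i" if "F \<in> ?P" "i < k" for F i
      using that assms(2) by (fastforce simp: PiE_def Pi_def)
    then show "\<forall>F\<in>?P. (\<lambda>i\<in>{..<k}. (\<Union>i<k. F i) \<inter> ?V i) = F"
      by (intro ballI PiE_ext[of _ "{..<k}" "\<lambda>i. UNIV"]) (auto simp: PiE_def Pi_def extensional_def)
    show "(\<lambda>e. \<lambda>i\<in>{..<k}. e \<inter> ?V i) ` sets_of_type V cls k a \<subseteq> ?P"
      by (auto simp: sets_of_type_def)
    show "(\<lambda>F. \<Union>i<k. F i) ` ?P \<subseteq> sets_of_type V cls k a"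
    proof
      fix e assume "e \<in> (\<lambda>F. \<Union>i<k. F i) ` ?P"
      then obtain F where F: "F \<in> ?P" "e = (\<Union>i<k. F i)" by auto
      have "e \<subseteq> V" using F by (fastforce simp: PiE_def Pi_def)
      moreover have "card (e \<inter> ?V i) = a i" if "i < k" for i
        using *[OF F(1) that] F that by (auto simp: PiE_def Pi_def)
      ultimately show "e \<in> sets_of_type V cls k a" by (simp add: sets_of_type_def)
    qed
  qed
  then have "card (sets_of_type V cls k a) = card ?P" by (rule bij_betw_same_card)
  also have "\<dots> = (\<Prod>i<k. card (?V i) choose a i)"
    using assms(1) by (simp add: card_PiE n_subsets)
  finally show ?thesis .
qed

lemma card_eq_sum_classes:
  fixes cls :: "'a \<Rightarrow> nat"
  assumes "finite V" "\<And>v. v \<in> V \<Longrightarrow> cls v < k" "e \<subseteq> V"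
  shows "card e = (\<Sum>i<k. card (e \<inter> {v \<in> V. cls v = i}))"
proof -
  have "e = (\<Union>i<k. e \<inter> {v \<in> V. cls v = i})" using assms(2,3) by auto
  also have "card \<dots> = (\<Sum>i<k. card (e \<inter> {v \<in> V. cls v = i}))"
    using assms(1) by (intro card_UN_disjoint) auto
  finally show ?thesis .
qed

text \<open>Edge types are encoded by the numbers \<open>l < (t + 1)\<^sup>k\<close>: digit \<open>i\<close> counts the vertices in class \<open>i\<close>.\<close>

definition type_size :: "nat \<Rightarrow> nat \<Rightarrow> (nat \<Rightarrow> nat) \<Rightarrow> nat \<Rightarrow> nat" where
  "type_size t k n l = (if (\<Sum>i<k. digit (t + 1) l i) = t then \<Prod>i<k. n i choose digit (t + 1) l i else 0)"

text \<open>Left to right, \<open>x l\<close> counts the edges of type \<open>l\<close>. Right to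
  left, any \<open>x l\<close> sets of each type \<open>l\<close> give the classes the degree sums
  \<open>n i * d i\<close>, and exchanges make the single degrees right. A number \<open>l\<close>
  whose digit sum is not \<open>t\<close> is no type; \<open>type_size\<close> forces its variable
  to 0.\<close>

lemma realizable_iff_types:
  assumes "finite V" "\<And>v. v \<in> V \<Longrightarrow> cls v < k" "\<And>i. i < k \<Longrightarrow> card {v \<in> V. cls v = i} = n i"
  shows "(\<exists>E \<subseteq> nsets V t. \<forall>v\<in>V. degree_in E v = d (cls v)) \<longleftrightarrow>
    (\<exists>x. (\<forall>l<(t + 1) ^ k. x l \<le> type_size t k n l) \<and>
      (\<forall>i<k. (\<Sum>l<(t + 1) ^ k. digit (t + 1) l i * x l) = n i * d i))"
    (is "?L \<longleftrightarrow> ?R")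
proof
  let ?V = "\<lambda>i. {v \<in> V. cls v = i}"
  have fV: "finite (?V i)" for i using assms(1) by simp
  {
    assume ?L
    then obtain E where E: "E \<subseteq> nsets V t" "\<forall>v\<in>V. degree_in E v = d (cls v)" by auto
    have fE: "finite E" using E(1) finite_imp_finite_nsets[OF assms(1)] finite_subset by blast
    define code where "code e = from_digits (t + 1) (\<lambda>i. card (e \<inter> ?V i)) k" for e
    have e: "e \<subseteq> V" "card e = t" if "e \<in> E" for e using that E(1) by (auto simp: nsets_def)
    have le: "card (e \<inter> ?V i) < t + 1" if "e \<in> E" for e i
      using card_mono[of e "e \<inter> ?V i"] e[OF that] finite_subset[OF _ assms(1)] by (simp add: le_imp_less_Suc)
    have dg: "digit (t + 1) (code e) i = card (e \<inter> ?V i)" if "e \<in> E" "i < k" for e i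
      unfolding code_def using le[OF that(1)] that(2) by (intro digit_from_digits) auto
    have "code e < (t + 1) ^ k" if "e \<in> E" for e
      unfolding code_def using le[OF that] by (intro from_digits_less)
    then have cl: "code ` E \<subseteq> {..<(t + 1) ^ k}" by auto
    define x where "x l = card {e \<in> E. code e = l}" for l
    have "x l \<le> type_size t k n l" for l
    proof (cases "{e \<in> E. code e = l} = {}")
      case True
      then show ?thesis by (simp only: x_def) simp
    next
      case False
      then obtain e0 where e0: "e0 \<in> E" "code e0 = l" by auto
      have "(\<Sum>i<k. digit (t + 1) l i) = (\<Sum>i<k. card (e0 \<inter> ?V i))"
        using dg e0 by (intro sum.cong) auto
      also have "\<dots> = t" using card_eq_sum_classes[OF assms(1,2) e(1)[OF e0(1)]] e(2)[OF e0(1)] by simp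
      finally have "type_size t k n l = (\<Prod>i<k. card (?V i) choose digit (t + 1) l i)"
        using assms(3) by (simp add: type_size_def)
      also have "\<dots> = card (sets_of_type V cls k (digit (t + 1) l))"
        using card_sets_of_type[OF assms(1,2)] by simp
      also have "\<dots> \<ge> x l" unfolding x_def
        using e dg assms(1) by (intro card_mono) (auto simp: sets_of_type_def)
      finally show ?thesis .
    qed
    moreover have "(\<Sum>l<(t + 1) ^ k. digit (t + 1) l i * x l) = n i * d i" if "i < k" for i
    proof -
      have "(\<Sum>e | e \<in> E \<and> code e = l. card (e \<inter> ?V i)) = (\<Sum>e | e \<in> E \<and> code e = l. digit (t + 1) l i)" for l
        using dg[OF _ that] by (intro sum.cong refl) auto
      then have "(\<Sum>l<(t + 1) ^ k. digit (t + 1) l i * x l)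
        = (\<Sum>l<(t + 1) ^ k. \<Sum>e | e \<in> E \<and> code e = l. card (e \<inter> ?V i))"
        by (simp add: x_def mult.commute)
      also have "\<dots> = (\<Sum>e\<in>E. card (e \<inter> ?V i))"
        using sum.group[OF fE _ cl] by simp
      also have "\<dots> = (\<Sum>v\<in>?V i. degree_in E v)" using sum_degrees[OF fE fV] by simp
      also have "\<dots> = (\<Sum>v\<in>?V i. d i)" using E(2) by (intro sum.cong) auto
      finally show ?thesis using assms(3)[OF that] by simp
    qed
    ultimately show ?R by blast
  next
    assume ?R
    then obtain x where x: "\<And>l. l < (t + 1) ^ k \<Longrightarrow> x l \<le> type_size t k n l"
      "\<And>i. i < k \<Longrightarrow> (\<Sum>l<(t + 1) ^ k. digit (t + 1) l i * x l) = n i * d i" by auto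
    have "\<exists>F. F \<subseteq> sets_of_type V cls k (digit (t + 1) l) \<inter> nsets V t \<and> card F = x l"
      if "l < (t + 1) ^ k" for l
    proof (cases "(\<Sum>i<k. digit (t + 1) l i) = t")
      case False
      with x(1)[OF that] show ?thesis by (intro exI[of _ "{}"]) (simp add: type_size_def)
    next
      case True
      with x(1)[OF that] have "x l \<le> card (sets_of_type V cls k (digit (t + 1) l))"
        using card_sets_of_type[OF assms(1,2)] assms(3) by (simp add: type_size_def)
      then obtain F where F: "F \<subseteq> sets_of_type V cls k (digit (t + 1) l)" "card F = x l"
        using obtain_subset_with_card_n by metis
      moreover have "F \<subseteq> nsets V t"
      proof
        fix e assume "e \<in> F"
        with F have e: "e \<subseteq> V" "\<And>i. i < k \<Longrightarrow> card (e \<inter> ?V i) = digit (t + 1) l i"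
          by (auto simp: sets_of_type_def)
        from card_eq_sum_classes[OF assms(1,2) e(1)] e(2) True have "card e = t" by simp
        then show "e \<in> nsets V t" using e(1) assms(1) finite_subset by (auto simp: nsets_def)
      qed
      ultimately show ?thesis by blast
    qed
    then obtain F where F: "\<And>l. l < (t + 1) ^ k \<Longrightarrow> F l \<subseteq> sets_of_type V cls k (digit (t + 1) l)"
      "\<And>l. l < (t + 1) ^ k \<Longrightarrow> F l \<subseteq> nsets V t"
      "\<And>l. l < (t + 1) ^ k \<Longrightarrow> card (F l) = x l" by (metis le_inf_iff)
    define E where "E = (\<Union>l<(t + 1) ^ k. F l)"
    have E: "E \<subseteq> nsets V t" using F(2) by (auto simp: E_def)
    have fE: "finite E" using E(1) finite_imp_finite_nsets[OF assms(1)] finite_subset by blast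
    have fF: "finite (F l)" if "l < (t + 1) ^ k" for l
      by (rule finite_subset[OF _ fE]) (use that in \<open>auto simp: E_def\<close>)
    have disj: "F l \<inter> F l' = {}" if "l < (t + 1) ^ k" "l' < (t + 1) ^ k" "l \<noteq> l'" for l l'
    proof (rule ccontr)
      assume "F l \<inter> F l' \<noteq> {}"
      then obtain e where "e \<in> F l" "e \<in> F l'" by blast
      then have "e \<in> sets_of_type V cls k (digit (t + 1) l)" "e \<in> sets_of_type V cls k (digit (t + 1) l')"
        using F(1)[OF that(1)] F(1)[OF that(2)] by auto
      then have "digit (t + 1) l i = digit (t + 1) l' i" if "i < k" for i
        using that by (simp add: sets_of_type_def)
      \<comment> \<open>Both numbers are below \<open>(t + 1) ^ k\<close>, hence determined by their
        first \<open>k\<close> digits.\<close>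
      then have "from_digits (t + 1) (digit (t + 1) l) k = from_digits (t + 1) (digit (t + 1) l') k"
        by (simp add: from_digits_def)
      then show False using that by (simp add: from_digits_digit)
    qed
    have sums: "(\<Sum>v\<in>?V i. degree_in E v) = n i * d i" if "i < k" for i
    proof -
      have "(\<Sum>v\<in>?V i. degree_in E v) = (\<Sum>e\<in>E. card (e \<inter> ?V i))" by (rule sum_degrees[OF fE fV])
      also have "\<dots> = (\<Sum>l<(t + 1) ^ k. \<Sum>e\<in>F l. card (e \<inter> ?V i))"
        unfolding E_def using fF disj by (intro sum.UNION_disjoint) auto
      also have "\<dots> = (\<Sum>l<(t + 1) ^ k. \<Sum>e\<in>F l. digit (t + 1) l i)"
        using F(1) that by (intro sum.cong refl) (auto simp: sets_of_type_def)
      also have "\<dots> = (\<Sum>l<(t + 1) ^ k. digit (t + 1) l i * x l)"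
        using F(3) by (intro sum.cong refl) simp
      finally show ?thesis using x(2)[OF that] by simp
    qed
    have "(\<Sum>v\<in>?V i. degree_in E v) = card (?V i) * d i" for i
    proof (cases "i < k")
      case True
      then show ?thesis using sums assms(3) by simp
    next
      case False
      \<comment> \<open>\<open>regularize_degrees\<close> asks for the sum of every class; those
        with index at least \<open>k\<close> are empty.\<close>
      then have "?V i = {}" using assms(2) by auto
      then show ?thesis by (metis card.empty mult_0 sum.empty)
    qed
    from regularize_degrees[OF assms(1) E this] show ?L by blast
  }
qed

section \<open>Vertex classes of a compressed sequence\<close>

text \<open>Induction from the right: a new last pair appends its block of vertices behind the
  others, whose positions and classes stay the same.\<close>

lemma expand_classes:
  "\<exists>cls. (\<forall>v<length (expand ds). cls v < length ds \<and> expand ds ! v = fst (ds ! cls v)) \<and>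
     (\<forall>i<length ds. card {v \<in> {..<length (expand ds)}. cls v = i} = snd (ds ! i))"
proof (induction ds rule: rev_induct)
  case (snoc y ds)
  obtain \<delta> n where y: "y = (\<delta>, n)" by fastforce
  from snoc obtain cls where c: "\<And>v. v < length (expand ds) \<Longrightarrow> cls v < length ds \<and> expand ds ! v = fst (ds ! cls v)"
    "\<And>i. i < length ds \<Longrightarrow> card {v \<in> {..<length (expand ds)}. cls v = i} = snd (ds ! i)" by blast
  let ?m = "length (expand ds)"
  have ex: "expand (ds @ [y]) = expand ds @ replicate n \<delta>" by (simp add: expand_def y)
  define cls' where "cls' v = (if v < ?m then cls v else length ds)" for v
  have "cls' v < length (ds @ [y]) \<and> expand (ds @ [y]) ! v = fst ((ds @ [y]) ! cls' v)"
    if "v < length (expand (ds @ [y]))" for v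
    using c(1)[of v] that unfolding ex by (auto simp: cls'_def nth_append y)
  moreover have "card {v \<in> {..<length (expand (ds @ [y]))}. cls' v = i} = snd ((ds @ [y]) ! i)"
    if "i < length (ds @ [y])" for i
  proof (cases "i = length ds")
    case True
    have "cls v \<noteq> length ds" if "v < ?m" for v using c(1)[OF that] by auto
    then have "{v \<in> {..<length (expand (ds @ [y]))}. cls' v = i} = {?m..<?m + n}"
      using True unfolding ex by (force simp: cls'_def split: if_splits)
    then show ?thesis by (simp add: True y)
  next
    case False
    then have "{v \<in> {..<length (expand (ds @ [y]))}. cls' v = i} = {v \<in> {..<?m}. cls v = i}"
      unfolding ex by (auto simp: cls'_def split: if_splits)
    then show ?thesis using c(2)[of i] False that by (simp add: nth_append)
  qed
  ultimately show ?case by blast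
qed (simp add: expand_def)

lemma hypergraphical_iff_types:
  "hypergraphical t (expand ds) \<longleftrightarrow>
    (\<exists>x. (\<forall>l<(t + 1) ^ length ds. x l \<le> type_size t (length ds) (\<lambda>i. snd (ds ! i)) l) \<and>
      (\<forall>i<length ds. (\<Sum>l<(t + 1) ^ length ds. digit (t + 1) l i * x l) = snd (ds ! i) * fst (ds ! i)))"
proof -
  from expand_classes[of ds] obtain cls where c:
    "\<And>v. v < length (expand ds) \<Longrightarrow> cls v < length ds \<and> expand ds ! v = fst (ds ! cls v)"
    "\<And>i. i < length ds \<Longrightarrow> card {v \<in> {..<length (expand ds)}. cls v = i} = snd (ds ! i)" by blast
  have "hypergraphical t (expand ds) \<longleftrightarrow>
    (\<exists>E \<subseteq> nsets {..<length (expand ds)} t. \<forall>v\<in>{..<length (expand ds)}. degree_in E v = fst (ds ! cls v))"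
    using c(1) by (auto simp: hypergraphical_def uniform_hypergraph_def)
  also have "\<dots> \<longleftrightarrow> (\<exists>x. (\<forall>l<(t + 1) ^ length ds. x l \<le> type_size t (length ds) (\<lambda>i. snd (ds ! i)) l) \<and>
      (\<forall>i<length ds. (\<Sum>l<(t + 1) ^ length ds. digit (t + 1) l i * x l) = snd (ds ! i) * fst (ds ! i)))"
    by (rule realizable_iff_types[where d = "\<lambda>i. fst (ds ! i)"]) (use c in auto)
  finally show ?thesis .
qed

section \<open>The carry automaton\<close>

text \<open>A solution of \<open>\<Sum>\<^sub>l C i l * x l = b i\<close> is read from the least significant bits upwards:
  \<open>c\<close> is the vector of carries after \<open>j\<close> bits.\<close>

definition carry_reachable ::
    "(nat \<Rightarrow> nat \<Rightarrow> nat) \<Rightarrow> nat \<Rightarrow> nat \<Rightarrow> (nat \<Rightarrow> nat) \<Rightarrow> nat \<Rightarrow> (nat \<Rightarrow> nat) \<Rightarrow> bool" where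
  "carry_reachable C m n b j c \<longleftrightarrow> (\<exists>x. (\<forall>l<n. x l < 2 ^ j) \<and>
     (\<forall>i<m. (\<Sum>l<n. C i l * x l) = b i mod 2 ^ j + 2 ^ j * c i))"

lemma carry_reachable_cong:
  "(\<And>i. i < m \<Longrightarrow> c i = c' i) \<Longrightarrow> carry_reachable C m n b j c \<longleftrightarrow> carry_reachable C m n b j c'"
  by (simp add: carry_reachable_def)

lemma carry_reachable_0: "carry_reachable C m n b 0 c \<longleftrightarrow> (\<forall>i<m. c i = 0)"
  by (auto simp: carry_reachable_def intro!: exI[of _ "\<lambda>_. 0"])

lemma mod_two_power_Suc: "a mod 2 ^ Suc j = a mod 2 ^ j + 2 ^ j * (a div 2 ^ j mod 2 :: nat)"
  using mod_mult2_eq[of a "2 ^ j" 2] by (simp add: mult.commute)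

text \<open>Write \<open>x = y + 2 ^ j * z\<close> with \<open>z\<close> the new top bit. Modulo
  \<open>2 ^ j\<close> only \<open>y\<close> is visible, which yields its carry \<open>c\<close>;
  cancelling the low parts and the factor \<open>2 ^ j\<close> leaves one addition with carry per
  equation.\<close>

lemma carry_reachable_Suc:
  "carry_reachable C m n b (Suc j) c' \<longleftrightarrow>
    (\<exists>z c. (\<forall>l<n. z l < 2) \<and> carry_reachable C m n b j c \<and>
      (\<forall>i<m. (\<Sum>l<n. C i l * z l) + c i = b i div 2 ^ j mod 2 + 2 * c' i))"
proof
  assume "carry_reachable C m n b (Suc j) c'"
  then obtain x where x: "\<And>l. l < n \<Longrightarrow> x l < 2 ^ Suc j"
    "\<And>i. i < m \<Longrightarrow> (\<Sum>l<n. C i l * x l) = b i mod 2 ^ Suc j + 2 ^ Suc j * c' i"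
    by (auto simp: carry_reachable_def)
  define y where "y l = x l mod 2 ^ j" for l
  define z where "z l = x l div 2 ^ j" for l
  define c where "c i = (\<Sum>l<n. C i l * y l) div 2 ^ j" for i
  have split: "(\<Sum>l<n. C i l * x l) = (\<Sum>l<n. C i l * y l) + 2 ^ j * (\<Sum>l<n. C i l * z l)" for i
  proof -
    have "C i l * x l = C i l * y l + 2 ^ j * (C i l * z l)" for l
      using mod_mult_div_eq[of "x l" "2 ^ j"] unfolding y_def z_def
      by (metis add_mult_distrib2 mult.left_commute)
    then show ?thesis by (simp add: sum.distrib sum_distrib_left)
  qed
  have eq: "(\<Sum>l<n. C i l * y l) + 2 ^ j * (\<Sum>l<n. C i l * z l)
      = b i mod 2 ^ j + 2 ^ j * (b i div 2 ^ j mod 2 + 2 * c' i)" if "i < m" for i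
    using x(2)[OF that] unfolding split mod_two_power_Suc by (simp add: algebra_simps)
  have y: "(\<Sum>l<n. C i l * y l) = b i mod 2 ^ j + 2 ^ j * c i" if "i < m" for i
  proof -
    have "(\<Sum>l<n. C i l * y l) mod 2 ^ j = b i mod 2 ^ j"
      using arg_cong[OF eq[OF that], of "\<lambda>v. v mod 2 ^ j"] by simp
    then show ?thesis
      using mod_mult_div_eq[of "\<Sum>l<n. C i l * y l" "2 ^ j"] by (simp add: c_def)
  qed
  have "(\<Sum>l<n. C i l * z l) + c i = b i div 2 ^ j mod 2 + 2 * c' i" if "i < m" for i
  proof -
    have "2 ^ j * ((\<Sum>l<n. C i l * z l) + c i) = 2 ^ j * (b i div 2 ^ j mod 2 + 2 * c' i)"
      using eq[OF that] y[OF that] by (simp only: distrib_left)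
    then show ?thesis by simp
  qed
  moreover have "z l < 2" if "l < n" for l
    using x(1)[OF that] by (simp add: z_def less_mult_imp_div_less)
  moreover have "carry_reachable C m n b j c"
    using y unfolding carry_reachable_def by (intro exI[of _ y]) (simp add: y_def)
  ultimately show "\<exists>z c. (\<forall>l<n. z l < 2) \<and> carry_reachable C m n b j c \<and>
      (\<forall>i<m. (\<Sum>l<n. C i l * z l) + c i = b i div 2 ^ j mod 2 + 2 * c' i)" by blast
next
  assume "\<exists>z c. (\<forall>l<n. z l < 2) \<and> carry_reachable C m n b j c \<and>
      (\<forall>i<m. (\<Sum>l<n. C i l * z l) + c i = b i div 2 ^ j mod 2 + 2 * c' i)"
  then obtain z c x where z: "\<And>l. l < n \<Longrightarrow> z l < 2"
    "\<And>i. i < m \<Longrightarrow> (\<Sum>l<n. C i l * z l) + c i = b i div 2 ^ j mod 2 + 2 * c' i"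
    and x: "\<And>l. l < n \<Longrightarrow> x l < 2 ^ j"
    "\<And>i. i < m \<Longrightarrow> (\<Sum>l<n. C i l * x l) = b i mod 2 ^ j + 2 ^ j * c i"
    unfolding carry_reachable_def by blast
  have "x l + 2 ^ j * z l < 2 ^ Suc j" if "l < n" for l
  proof -
    have "z l \<le> 1" using z(1)[OF that] by simp
    then have "2 ^ j * z l \<le> 2 ^ j * 1" by (rule mult_le_mono2)
    then show ?thesis using x(1)[OF that] unfolding power_Suc by linarith
  qed
  moreover have "(\<Sum>l<n. C i l * (x l + 2 ^ j * z l)) = b i mod 2 ^ Suc j + 2 ^ Suc j * c' i" if "i < m" for i
  proof -
    have "(\<Sum>l<n. C i l * (x l + 2 ^ j * z l)) = (\<Sum>l<n. C i l * x l) + 2 ^ j * (\<Sum>l<n. C i l * z l)"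
      by (simp add: algebra_simps sum.distrib sum_distrib_left)
    also have "\<dots> = b i mod 2 ^ j + 2 ^ j * ((\<Sum>l<n. C i l * z l) + c i)"
      using x(2)[OF that] by (simp add: algebra_simps)
    finally show ?thesis unfolding z(2)[OF that] mod_two_power_Suc by (simp add: algebra_simps)
  qed
  ultimately show "carry_reachable C m n b (Suc j) c'"
    unfolding carry_reachable_def by (intro exI[of _ "\<lambda>l. x l + 2 ^ j * z l"]) auto
qed

text \<open>The values read so far are at most \<open>2 ^ j - 1\<close>, so
  \<open>2 ^ j * c i \<le> R * (2 ^ j - 1)\<close>. The resulting bound does not depend on
  \<open>j\<close>, which makes the automaton finite.\<close>

lemma carry_reachable_less:
  assumes "carry_reachable C m n b j c" "i < m" "(\<Sum>l<n. C i l) \<le> R" "0 < R"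
  shows "c i < R"
proof -
  from assms obtain x where x: "\<And>l. l < n \<Longrightarrow> x l < 2 ^ j"
    "(\<Sum>l<n. C i l * x l) = b i mod 2 ^ j + 2 ^ j * c i"
    by (auto simp: carry_reachable_def)
  have "x l \<le> 2 ^ j - 1" if "l < n" for l using x(1)[OF that] by simp
  note le = this
  have "2 ^ j * c i \<le> (\<Sum>l<n. C i l * x l)" using x(2) by simp
  also have "\<dots> \<le> (\<Sum>l<n. C i l * (2 ^ j - 1))"
    using le by (intro sum_mono mult_le_mono2) simp
  also have "\<dots> = (\<Sum>l<n. C i l) * (2 ^ j - 1)" by (simp add: sum_distrib_right)
  also have "\<dots> \<le> R * (2 ^ j - 1)" using assms(3) by (rule mult_le_mono1)
  also have "\<dots> < 2 ^ j * R" using assms(4) by (simp add: mult.commute)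
  finally show ?thesis by simp
qed

text \<open>Acceptance: once all bits of the right hand sides are consumed, zero carries mean that
  the equations hold exactly.\<close>

lemma carry_reachable_zero:
  assumes "\<And>i. i < m \<Longrightarrow> b i < 2 ^ j"
  shows "carry_reachable C m n b j (\<lambda>_. 0) \<longleftrightarrow>
    (\<exists>x. (\<forall>l<n. x l < 2 ^ j) \<and> (\<forall>i<m. (\<Sum>l<n. C i l * x l) = b i))"
  using assms by (simp add: carry_reachable_def)

text \<open>Slack variables turn the upper bounds of the program of edge types into equations:
  variable \<open>N + l\<close> is the slack of \<open>x l \<le> U l\<close>, which becomes equation \<open>k + l\<close>.\<close>

locale type_program =
  fixes t k :: nat and \<beta> U :: "nat \<Rightarrow> nat"
begin

definition N :: nat where "N = (t + 1) ^ k"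
text \<open>A common bound of the coefficient sums, which are at most \<open>N * t\<close> in a type
  row and equal to 2 in a slack row. Carries are thus digits in base \<open>B\<close>, and
  \<open>Q\<close> counts the vectors of \<open>k + N\<close> such digits.\<close>

definition B :: nat where "B = N * (t + 2)"
definition Q :: nat where "Q = B ^ (k + N)"

definition coef :: "nat \<Rightarrow> nat \<Rightarrow> nat" where
  "coef i l = (if i < k then if l < N then digit (t + 1) l i else 0
     else of_bool (l = i - k) + of_bool (l = N + (i - k)))"

definition rhs :: "nat \<Rightarrow> nat" where
  "rhs i = (if i < k then \<beta> i else U (i - k))"

definition bit_at :: "nat \<Rightarrow> nat \<Rightarrow> nat" where
  "bit_at p a = a div p mod 2"

text \<open>Addition with carry at the bit of value \<open>p\<close>: \<open>\<sigma>\<close> and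
  \<open>\<sigma>'\<close> encode the carries before and after, and the binary digits of
  \<open>z\<close> are the current bits of all \<open>2 * N\<close> variables. The rows avoid
  \<open>coef\<close> and have the form that the program evaluates.\<close>

definition transition :: "nat \<Rightarrow> nat \<Rightarrow> nat \<Rightarrow> nat \<Rightarrow> bool" where
  "transition p \<sigma> z \<sigma>' \<longleftrightarrow>
    (\<forall>i<k. (\<Sum>l<N. digit (t + 1) l i * digit 2 z l) + digit B \<sigma> i = bit_at p (\<beta> i) + 2 * digit B \<sigma>' i) \<and>
    (\<forall>l<N. digit 2 z l + digit 2 z (N + l) + digit B \<sigma> (k + l) = bit_at p (U l) + 2 * digit B \<sigma>' (k + l))"

definition step_set :: "nat \<Rightarrow> nat \<Rightarrow> nat" where
  "step_set p S = from_digits 2 (\<lambda>\<sigma>'. of_bool (\<exists>\<sigma><Q. \<exists>z<2 ^ (2 * N). digit 2 S \<sigma> = 1 \<and> transition p \<sigma> z \<sigma>')) Q"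

definition carry_set :: "nat \<Rightarrow> nat" where
  "carry_set j = from_digits 2 (\<lambda>\<sigma>. of_bool (carry_reachable coef (k + N) (2 * N) rhs j (digit B \<sigma>))) Q"

lemma N_pos: "0 < N" by (simp add: N_def)
lemma B_ge_2: "2 \<le> B" using N_pos mult_le_mono[of 1 N 2 "t + 2"] by (simp add: B_def)

lemma sum_coef_type:
  assumes "i < k"
  shows "(\<Sum>l<2 * N. coef i l * z l) = (\<Sum>l<N. digit (t + 1) l i * z l)"
proof -
  have "(\<Sum>l<2 * N. coef i l * z l) = (\<Sum>l<N. coef i l * z l)"
    by (rule sum.mono_neutral_right) (auto simp: coef_def assms)
  also have "\<dots> = (\<Sum>l<N. digit (t + 1) l i * z l)" by (simp add: coef_def assms)
  finally show ?thesis .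
qed

lemma sum_coef_slack:
  assumes "l < N"
  shows "(\<Sum>l'<2 * N. coef (k + l) l' * z l') = z l + z (N + l)"
proof -
  have "(\<Sum>l'<2 * N. coef (k + l) l' * z l')
      = (\<Sum>l'<2 * N. if l' = l then z l' else 0) + (\<Sum>l'<2 * N. if l' = N + l then z l' else 0)"
    unfolding sum.distrib[symmetric] by (intro sum.cong refl) (auto simp: coef_def)
  then show ?thesis using assms by simp
qed

lemma all_rows: "(\<forall>i<k + N. P i) \<longleftrightarrow> (\<forall>i<k. P i) \<and> (\<forall>l<N. P (k + l))"
proof -
  have "i < k \<or> (\<exists>l<N. i = k + l)" if "i < k + N" for i
    using that by presburger
  then show ?thesis by auto
qed

lemma row_sum_le:
  assumes "i < k + N"
  shows "(\<Sum>l<2 * N. coef i l) \<le> B"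
proof (cases "i < k")
  case True
  then have "(\<Sum>l<2 * N. coef i l) = (\<Sum>l<N. digit (t + 1) l i)"
    using sum_coef_type[of i "\<lambda>_. 1"] by simp
  also have "\<dots> \<le> (\<Sum>l<N. t)"
    by (intro sum_mono) (use digit_less[of "t + 1"] in \<open>simp add: less_Suc_eq_le\<close>)
  also have "\<dots> \<le> B" by (simp add: B_def)
  finally show ?thesis .
next
  case False
  then obtain l where l: "i = k + l" by (metis add_diff_inverse_nat)
  then show ?thesis using sum_coef_slack[of l "\<lambda>_. 1"] B_ge_2 assms by simp
qed

lemma transition_iff:
  "transition (2 ^ j) \<sigma> z \<sigma>' \<longleftrightarrow> (\<forall>i<k + N. (\<Sum>l<2 * N. coef i l * digit 2 z l) + digit B \<sigma> i
      = rhs i div 2 ^ j mod 2 + 2 * digit B \<sigma>' i)"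
  unfolding all_rows by (simp add: sum_coef_type sum_coef_slack transition_def bit_at_def rhs_def)

lemma digit_carry_set:
  "\<sigma> < Q \<Longrightarrow> digit 2 (carry_set j) \<sigma> = 1 \<longleftrightarrow>
    carry_reachable coef (k + N) (2 * N) rhs j (digit B \<sigma>)"
  unfolding carry_set_def by (subst digit_from_digits) auto

lemma carry_set_less: "carry_set j < 2 ^ Q"
  unfolding carry_set_def by (rule from_digits_less) auto

text \<open>Before any bit is read only the zero vector is reachable. Its number is 0, so the mask
  is \<open>2 ^ 0\<close>.\<close>

lemma carry_set_0: "carry_set 0 = 1"
proof -
  have "(\<forall>i<k + N. digit B \<sigma> i = 0) \<longleftrightarrow> \<sigma> = 0" if "\<sigma> < Q" for \<sigma>
  proof
    assume "\<forall>i<k + N. digit B \<sigma> i = 0"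
    then have "from_digits B (digit B \<sigma>) (k + N) = 0" by (simp add: from_digits_def)
    then show "\<sigma> = 0" using that B_ge_2 by (simp add: from_digits_digit Q_def)
  qed (simp add: digit_def)
  then have "carry_set 0 = from_digits 2 (\<lambda>\<sigma>. of_bool (\<sigma> = 0)) Q"
    by (simp add: carry_set_def from_digits_def carry_reachable_0)
  also have "\<dots> = (\<Sum>\<sigma><Q. if \<sigma> = 0 then 1 else 0)"
    unfolding from_digits_def by (intro sum.cong) auto
  also have "\<dots> = 1" using B_ge_2 by (simp add: Q_def)
  finally show ?thesis .
qed

text \<open>Searching the numbers \<open>\<sigma> < Q\<close> and \<open>z < 2 ^ (2 * N)\<close>
  misses nothing: the bits are digits in base 2, and reachable carries are below \<open>B\<close> by
  the coefficient sums.\<close>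

lemma step_carry_set: "step_set (2 ^ j) (carry_set j) = carry_set (Suc j)"
proof -
  have "(\<exists>\<sigma><Q. \<exists>z<2 ^ (2 * N). digit 2 (carry_set j) \<sigma> = 1 \<and> transition (2 ^ j) \<sigma> z \<sigma>')
    \<longleftrightarrow> carry_reachable coef (k + N) (2 * N) rhs (Suc j) (digit B \<sigma>')" for \<sigma>'
  proof
    assume "\<exists>\<sigma><Q. \<exists>z<2 ^ (2 * N). digit 2 (carry_set j) \<sigma> = 1 \<and> transition (2 ^ j) \<sigma> z \<sigma>'"
    then obtain \<sigma> z where "\<sigma> < Q" "digit 2 (carry_set j) \<sigma> = 1" "transition (2 ^ j) \<sigma> z \<sigma>'" by blast
    then show "carry_reachable coef (k + N) (2 * N) rhs (Suc j) (digit B \<sigma>')"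
      unfolding carry_reachable_Suc transition_iff using digit_carry_set[of \<sigma>] digit_less[of 2 z]
      by (intro exI[of _ "digit 2 z"] exI[of _ "digit B \<sigma>"]) simp
  next
    assume "carry_reachable coef (k + N) (2 * N) rhs (Suc j) (digit B \<sigma>')"
    then obtain z c where z: "\<And>l. l < 2 * N \<Longrightarrow> z l < 2"
      and c: "carry_reachable coef (k + N) (2 * N) rhs j c"
      and e: "\<And>i. i < k + N \<Longrightarrow> (\<Sum>l<2 * N. coef i l * z l) + c i = rhs i div 2 ^ j mod 2 + 2 * digit B \<sigma>' i"
      unfolding carry_reachable_Suc by blast
    have cB: "c i < B" if "i < k + N" for i
      using carry_reachable_less[OF c that row_sum_le[OF that]] B_ge_2 by simp
    define \<zeta> where "\<zeta> = from_digits 2 z (2 * N)"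
    define \<sigma> where "\<sigma> = from_digits B c (k + N)"
    have \<zeta>: "\<zeta> < 2 ^ (2 * N)" unfolding \<zeta>_def using z by (rule from_digits_less)
    have \<sigma>: "\<sigma> < Q" unfolding \<sigma>_def Q_def using cB by (rule from_digits_less)
    have dz: "digit 2 \<zeta> l = z l" if "l < 2 * N" for l
      unfolding \<zeta>_def using z that by (intro digit_from_digits)
    have dc: "digit B \<sigma> i = c i" if "i < k + N" for i
      unfolding \<sigma>_def using cB that by (intro digit_from_digits)
    have "carry_reachable coef (k + N) (2 * N) rhs j (digit B \<sigma>)"
      using c carry_reachable_cong[of "k + N" "digit B \<sigma>" c, OF dc] by simp
    then have "digit 2 (carry_set j) \<sigma> = 1" using digit_carry_set[OF \<sigma>] by simp
    moreover have "transition (2 ^ j) \<sigma> \<zeta> \<sigma>'"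
      unfolding transition_iff using e dc dz by simp
    ultimately show "\<exists>\<sigma><Q. \<exists>z<2 ^ (2 * N). digit 2 (carry_set j) \<sigma> = 1 \<and> transition (2 ^ j) \<sigma> z \<sigma>'"
      using \<zeta> \<sigma> by blast
  qed
  then show ?thesis by (simp add: step_set_def carry_set_def)
qed

lemma carry_set_final:
  assumes "\<And>i. i < k \<Longrightarrow> \<beta> i < 2 ^ j" "\<And>l. l < N \<Longrightarrow> U l < 2 ^ j"
  shows "digit 2 (carry_set j) 0 = 1 \<longleftrightarrow>
    (\<exists>x. (\<forall>l<N. x l \<le> U l) \<and> (\<forall>i<k. (\<Sum>l<N. digit (t + 1) l i * x l) = \<beta> i))"
proof -
  have rl: "rhs i < 2 ^ j" if "i < k + N" for i
    using assms that by (auto simp: rhs_def)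
  have "digit 2 (carry_set j) 0 = 1 \<longleftrightarrow> carry_reachable coef (k + N) (2 * N) rhs j (digit B 0)"
    using B_ge_2 by (intro digit_carry_set) (simp add: Q_def)
  also have "digit B 0 = (\<lambda>_. 0)" by (simp add: digit_def fun_eq_iff)
  also have "carry_reachable coef (k + N) (2 * N) rhs j (\<lambda>_. 0) \<longleftrightarrow>
    (\<exists>x. (\<forall>l<2 * N. x l < 2 ^ j) \<and> (\<forall>i<k + N. (\<Sum>l<2 * N. coef i l * x l) = rhs i))"
    using rl by (rule carry_reachable_zero)
  also have "\<dots> \<longleftrightarrow> (\<exists>x. (\<forall>l<2 * N. x l < 2 ^ j) \<and> (\<forall>i<k. (\<Sum>l<N. digit (t + 1) l i * x l) = \<beta> i) \<and>
      (\<forall>l<N. x l + x (N + l) = U l))"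
    unfolding all_rows by (simp add: sum_coef_type sum_coef_slack rhs_def)
  also have "\<dots> \<longleftrightarrow> (\<exists>x. (\<forall>l<N. x l \<le> U l) \<and> (\<forall>i<k. (\<Sum>l<N. digit (t + 1) l i * x l) = \<beta> i))"
    (is "?L \<longleftrightarrow> ?R")
  proof
    assume ?L
    then show ?R by (metis le_add1)
  next
    assume ?R
    then obtain x where x: "\<And>l. l < N \<Longrightarrow> x l \<le> U l"
      "\<And>i. i < k \<Longrightarrow> (\<Sum>l<N. digit (t + 1) l i * x l) = \<beta> i" by blast
    \<comment> \<open>The slack of \<open>x l\<close> is \<open>U l - x l\<close>, which is below
      \<open>2 ^ j\<close> because \<open>U l\<close> is.\<close>
    define y where "y l = (if l < N then x l else U (l - N) - x (l - N))" for l
    have "y l < 2 ^ j" if "l < 2 * N" for l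
    proof (cases "l < N")
      case True
      then show ?thesis using x(1)[of l] assms(2)[of l] by (simp add: y_def)
    next
      case False
      with that have "l - N < N" by simp
      then show ?thesis using assms(2)[of "l - N"] False by (simp add: y_def less_imp_diff_less)
    qed
    moreover have "(\<Sum>l<N. digit (t + 1) l i * y l) = \<beta> i" if "i < k" for i
      using x(2)[OF that] by (simp add: y_def)
    moreover have "y l + y (N + l) = U l" if "l < N" for l
      using x(1)[OF that] that by (simp add: y_def)
    ultimately show ?L by blast
  qed
  finally show ?thesis .
qed

end

section \<open>The decision procedure\<close>

text \<open>Only nonnegative addresses are constrained, so the property survives all changes of loop
  variables.\<close>

definition reads_input :: "mem \<Rightarrow> nat \<Rightarrow> (nat \<times> nat) list \<Rightarrow> bool" where
  "reads_input m t ds \<longleftrightarrow> (\<forall>a\<ge>0. m a = input_mem (encode_input t ds) a)"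

lemma reads_input_upd [simp]:
  "reads_input (m(idx_addr v := x)) t ds \<longleftrightarrow> reads_input m t ds"
  "reads_input (m(acc_addr v := x)) t ds \<longleftrightarrow> reads_input m t ds"
  by (auto simp: reads_input_def addr_nonneg_neq[THEN not_sym])

lemma concat_pairs_nth:
  "i < length ds \<Longrightarrow> concat (map (\<lambda>(\<delta>, n). [int \<delta>, int n]) ds) ! (2 * i) = int (fst (ds ! i))"
  "i < length ds \<Longrightarrow> concat (map (\<lambda>(\<delta>, n). [int \<delta>, int n]) ds) ! Suc (2 * i) = int (snd (ds ! i))"
  by (induction ds arbitrary: i) (auto simp: nth_Cons split: nat.split)

lemma length_encode_input: "length (encode_input t ds) = 2 + 2 * length ds"
proof -
  have "length (concat (map (\<lambda>(\<delta>, n). [int \<delta>, int n]) ds)) = 2 * length ds"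
    by (induction ds) auto
  then show ?thesis by (simp add: encode_input_def)
qed

lemma reads_input_registers:
  assumes "reads_input m t ds"
  shows "m 0 = int t" "m 1 = int (length ds)"
    "i < length ds \<Longrightarrow> m (2 + 2 * int i) = int (fst (ds ! i))"
    "i < length ds \<Longrightarrow> m (3 + 2 * int i) = int (snd (ds ! i))"
proof -
  have m: "m (int a) = encode_input t ds ! a" if "a < 2 + 2 * length ds" for a
    using assms that by (simp add: reads_input_def input_mem_def length_encode_input)
  show "m 0 = int t" "m 1 = int (length ds)"
    using m[of 0] m[of 1] by (simp_all add: encode_input_def)
  assume i: "i < length ds"
  have "int (2 + 2 * i) = 2 + 2 * int i" "int (3 + 2 * i) = 3 + 2 * int i" by auto
  then show "m (2 + 2 * int i) = int (fst (ds ! i))" "m (3 + 2 * int i) = int (snd (ds ! i))"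
    using m[of "2 + 2 * i"] m[of "3 + 2 * i"] i concat_pairs_nth[OF i]
    by (simp_all add: encode_input_def numeral_3_eq_3)
qed

abbreviation plus_tm :: "tm \<Rightarrow> tm \<Rightarrow> tm" (infixl "+." 65) where "a +. b \<equiv> Bin Plus a b"
abbreviation minus_tm :: "tm \<Rightarrow> tm \<Rightarrow> tm" (infixl "-." 65) where "a -. b \<equiv> Bin Minus a b"
abbreviation times_tm :: "tm \<Rightarrow> tm \<Rightarrow> tm" (infixl "*." 70) where "a *. b \<equiv> Bin Times a b"
abbreviation quot_tm :: "tm \<Rightarrow> tm \<Rightarrow> tm" (infixl "div." 70) where "a div. b \<equiv> Bin Quot a b"

definition mod_tm :: "tm \<Rightarrow> tm \<Rightarrow> tm" where "mod_tm a b = a -. b *. (a div. b)"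
text \<open>Positivity is the only test of the language; a square is positive exactly when it is
  nonzero.\<close>

definition eq_tm :: "tm \<Rightarrow> tm \<Rightarrow> tm" where "eq_tm a b = Cst 1 -. Pos ((a -. b) *. (a -. b))"
definition sum_tm :: "nat \<Rightarrow> tm \<Rightarrow> tm \<Rightarrow> tm" where "sum_tm v n b = Iter v n (Cst 0) (Acc v +. b)"
definition prod_tm :: "nat \<Rightarrow> tm \<Rightarrow> tm \<Rightarrow> tm" where "prod_tm v n b = Iter v n (Cst 1) (Acc v *. b)"
definition ex_tm :: "nat \<Rightarrow> tm \<Rightarrow> tm \<Rightarrow> tm" where "ex_tm v n b = Pos (sum_tm v n b)"
definition pow_tm :: "nat \<Rightarrow> tm \<Rightarrow> tm \<Rightarrow> tm" where "pow_tm v b e = prod_tm v e b"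
definition digit_tm :: "nat \<Rightarrow> tm \<Rightarrow> tm \<Rightarrow> tm \<Rightarrow> tm" where
  "digit_tm v b x i = mod_tm (x div. pow_tm v b i) b"
text \<open>The multiplicative recurrence, with an exact division in each round. It takes
  \<open>a\<close> rounds however large \<open>n\<close> is; in its use below \<open>a\<close> is a
  digit in base \<open>t + 1\<close>.\<close>

definition binomial_tm :: "nat \<Rightarrow> tm \<Rightarrow> tm \<Rightarrow> tm" where
  "binomial_tm v n a = Iter v a (Cst 1) ((Acc v *. (n -. Idx v)) div. (Idx v +. Cst 1))"

lemma val_mod: "val (mod_tm a b) m = val a m mod val b m"
  by (simp add: mod_tm_def minus_mult_div_eq_mod)

lemma val_eq: "val (eq_tm a b) m = of_bool (val a m = val b m)"
proof -
  have "(val a m - val b m) * (val a m - val b m) > 0 \<longleftrightarrow> val a m \<noteq> val b m"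
    by (metis eq_iff_diff_eq_0 not_square_less_zero mult_eq_0_iff linorder_less_linear less_irrefl)
  then show ?thesis by (simp add: eq_tm_def)
qed

lemma val_sum_int:
  assumes "val n m = int n'" "\<And>j x. j < n' \<Longrightarrow> val b (m(idx_addr v := int j, acc_addr v := x)) = g j"
  shows "val (sum_tm v n b) m = (\<Sum>j<n'. g j)"
proof -
  have "rec_nat 0 (\<lambda>j x. x + val b (m(idx_addr v := int j, acc_addr v := x))) i = (\<Sum>j<i. g j)"
    if "i \<le> n'" for i using that by (induction i) (simp_all add: assms(2) del: fun_upd_apply)
  then show ?thesis by (simp add: sum_tm_def assms(1))
qed

lemma val_prod_int:
  assumes "val n m = int n'" "\<And>j x. j < n' \<Longrightarrow> val b (m(idx_addr v := int j, acc_addr v := x)) = g j"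
  shows "val (prod_tm v n b) m = (\<Prod>j<n'. g j)"
proof -
  have "rec_nat 1 (\<lambda>j x. x * val b (m(idx_addr v := int j, acc_addr v := x))) i = (\<Prod>j<i. g j)"
    if "i \<le> n'" for i using that by (induction i) (simp_all add: assms(2) del: fun_upd_apply)
  then show ?thesis by (simp add: prod_tm_def assms(1))
qed

lemma val_sum:
  assumes "val n m = int n'" "\<And>j x. j < n' \<Longrightarrow> val b (m(idx_addr v := int j, acc_addr v := x)) = int (g j)"
  shows "val (sum_tm v n b) m = int (\<Sum>j<n'. g j)"
  using val_sum_int[where g = "\<lambda>j. int (g j)", OF assms] by simp

lemma val_prod:
  assumes "val n m = int n'" "\<And>j x. j < n' \<Longrightarrow> val b (m(idx_addr v := int j, acc_addr v := x)) = int (g j)"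
  shows "val (prod_tm v n b) m = int (\<Prod>j<n'. g j)"
  using val_prod_int[where g = "\<lambda>j. int (g j)", OF assms] by simp

text \<open>A product of truth values is their conjunction, so \<open>prod_tm\<close> doubles as a
  bounded universal quantifier.\<close>

lemma val_all:
  assumes "val n m = int n'" "\<And>j x. j < n' \<Longrightarrow> val b (m(idx_addr v := int j, acc_addr v := x)) = of_bool (P j)"
  shows "val (prod_tm v n b) m = of_bool (\<forall>j<n'. P j)"
proof -
  have "(\<Prod>j<n'. of_bool (P j)) = (of_bool (\<forall>j<n'. P j) :: int)"
    by (induction n') (auto simp: less_Suc_eq)
  then show ?thesis using val_prod_int[where g = "\<lambda>j. of_bool (P j)", OF assms] by simp
qed

lemma val_ex:
  assumes "val n m = int n'" "\<And>j x. j < n' \<Longrightarrow> val b (m(idx_addr v := int j, acc_addr v := x)) = of_bool (P j)"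
  shows "val (ex_tm v n b) m = of_bool (\<exists>j<n'. P j)"
proof -
  have "(\<Sum>j<n'. of_bool (P j)) > (0 :: int) \<longleftrightarrow> (\<exists>j<n'. P j)"
    using sum_nonneg_eq_0_iff[of "{..<n'}" "\<lambda>j. of_bool (P j) :: int"]
      sum_nonneg[of "{..<n'}" "\<lambda>j. of_bool (P j) :: int"] by (auto simp: order_less_le)
  then show ?thesis using val_sum_int[where g = "\<lambda>j. of_bool (P j)", OF assms] by (simp add: ex_tm_def)
qed

lemma val_pow:
  assumes "val e m = int e'" "\<And>j x. val b (m(idx_addr v := j, acc_addr v := x)) = int b'"
  shows "val (pow_tm v b e) m = int (b' ^ e')"
  unfolding pow_tm_def using val_prod[OF assms(1), of b v "\<lambda>_. b'"] assms(2) by simp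

lemma val_digit:
  assumes "val x m = int x'" "val i m = int i'" "val b m = int b'"
    "\<And>j x. val b (m(idx_addr v := j, acc_addr v := x)) = int b'"
  shows "val (digit_tm v b x i) m = int (digit b' x' i')"
  by (simp add: digit_tm_def val_mod val_pow[OF assms(2,4)] assms(1,3) digit_def zdiv_int zmod_int)

lemma binomial_step: "(n choose j) * (n - j) = (n choose Suc j) * Suc j"
  by (metis binomial_absorb_comp mult.commute times_binomial_minus1_eq zero_less_Suc diff_Suc_1 binomial_absorption)

lemma val_binomial:
  assumes "val a m = int a'" "\<And>j x. val n (m(idx_addr v := j, acc_addr v := x)) = int n'"
  shows "val (binomial_tm v n a) m = int (n' choose a')"
proof -
  have step: "int (n' choose j) * (int n' - int j) div (int j + 1) = int (n' choose Suc j)" for j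
  proof -
    have "int (n' choose j) * (int n' - int j) = int (n' choose Suc j) * (int j + 1)"
    proof (cases "j \<le> n'")
      case True
      then show ?thesis using arg_cong[OF binomial_step[of n' j], of int] by (simp add: of_nat_diff algebra_simps)
    \<comment> \<open>Beyond \<open>n'\<close> both binomial coefficients vanish, so the negative
      factor does no harm.\<close>
    qed (simp add: binomial_eq_0)
    then show ?thesis by simp
  qed
  have "rec_nat 1 (\<lambda>j x. x * (int n' - int j) div (int j + 1)) i = int (n' choose i)" for i
    by (induction i) (simp_all add: step)
  then show ?thesis by (simp add: binomial_tm_def assms del: fun_upd_apply) (simp add: fun_upd_def)
qed

text \<open>The numbers \<open>0, 1, \<dots>\<close> below name loop variables; nested loops have different names. The driver keeps
  the set of carries in \<open>Idx 20\<close>, the current power of 2 in \<open>Acc 20\<close> and a bound of all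
  right hand sides in \<open>Idx 21\<close>.\<close>

definition "t_tm = Inp (Cst 0)"
definition "k_tm = Inp (Cst 1)"
definition "degree_tm i = Inp (Cst 2 +. Cst 2 *. i)"
definition "mult_tm i = Inp (Cst 3 +. Cst 2 *. i)"
definition "N_tm = pow_tm 0 (t_tm +. Cst 1) k_tm"
definition "type_digit_tm l i = digit_tm 1 (t_tm +. Cst 1) l i"
definition "U_tm l = eq_tm (sum_tm 2 k_tm (type_digit_tm (Idx l) (Idx 2))) t_tm *.
  prod_tm 3 k_tm (binomial_tm 4 (mult_tm (Idx 3)) (type_digit_tm (Idx l) (Idx 3)))"
definition "B_tm = N_tm *. (t_tm +. Cst 2)"
definition "Q_tm = pow_tm 5 B_tm (k_tm +. N_tm)"
definition "beta_tm i = mult_tm i *. degree_tm i"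
definition "total_tm = sum_tm 6 k_tm (beta_tm (Idx 6)) +. sum_tm 7 N_tm (U_tm 7)"
definition "bit_tm a = mod_tm (a div. Acc 20) (Cst 2)"
definition "bin_digit_tm = digit_tm 16 (Cst 2)"
definition "carry_digit_tm = digit_tm 15 B_tm"
definition "type_row_tm = eq_tm
  (sum_tm 13 N_tm (type_digit_tm (Idx 13) (Idx 12) *. bin_digit_tm (Idx 11) (Idx 13))
    +. carry_digit_tm (Idx 10) (Idx 12))
  (bit_tm (beta_tm (Idx 12)) +. Cst 2 *. carry_digit_tm (Idx 8) (Idx 12))"
definition "slack_row_tm = eq_tm
  (bin_digit_tm (Idx 11) (Idx 14) +. bin_digit_tm (Idx 11) (N_tm +. Idx 14)
    +. carry_digit_tm (Idx 10) (k_tm +. Idx 14))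
  (bit_tm (U_tm 14) +. Cst 2 *. carry_digit_tm (Idx 8) (k_tm +. Idx 14))"
definition "transition_tm = prod_tm 12 k_tm type_row_tm *. prod_tm 14 N_tm slack_row_tm"
text \<open>The new mask is a sum of powers \<open>2 ^ \<sigma>'\<close>, one for each state that
  has a predecessor in the old mask.\<close>

definition "step_tm = sum_tm 8 Q_tm
  (ex_tm 10 Q_tm (ex_tm 11 (pow_tm 9 (Cst 2) (Cst 2 *. N_tm))
      (eq_tm (bin_digit_tm (Idx 20) (Idx 10)) (Cst 1) *. transition_tm))
    *. pow_tm 9 (Cst 2) (Idx 8))"

lemmas tm_defs = t_tm_def k_tm_def degree_tm_def mult_tm_def N_tm_def type_digit_tm_def U_tm_def
  B_tm_def Q_tm_def beta_tm_def total_tm_def bit_tm_def bin_digit_tm_def carry_digit_tm_def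
  type_row_tm_def slack_row_tm_def transition_tm_def step_tm_def
  mod_tm_def eq_tm_def sum_tm_def prod_tm_def ex_tm_def pow_tm_def digit_tm_def binomial_tm_def

text \<open>Degrees and multiplicities occur as operands only. Loop bounds are built from
  \<open>t\<close>, \<open>k\<close> and enclosing indices; even the count in
  \<open>binomial_tm\<close> is a digit of an index.\<close>

lemma oblivious_total: "oblivious {} total_tm"
  by (simp add: tm_defs)

text \<open>The mask \<open>Idx 20\<close> and the power \<open>Acc 20\<close> never reach a loop
  bound: a digit is extracted with a power whose exponent is its position.\<close>

lemma oblivious_step: "oblivious {} step_tm"
  by (simp add: tm_defs)

section \<open>Values of the terms of a round\<close>

locale hypergraph_input =
  fixes t :: nat and ds :: "(nat \<times> nat) list"
begin

definition \<beta> :: "nat \<Rightarrow> nat" where "\<beta> i = snd (ds ! i) * fst (ds ! i)"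
definition U :: "nat \<Rightarrow> nat" where "U = type_size t (length ds) (\<lambda>i. snd (ds ! i))"

sublocale type_program t "length ds" \<beta> U .

lemma val_t: "reads_input m t ds \<Longrightarrow> val t_tm m = int t"
  by (simp add: t_tm_def reads_input_registers)

lemma val_k: "reads_input m t ds \<Longrightarrow> val k_tm m = int (length ds)"
  by (simp add: k_tm_def reads_input_registers)

lemma val_mult:
  "reads_input m t ds \<Longrightarrow> val i m = int i' \<Longrightarrow> i' < length ds \<Longrightarrow> val (mult_tm i) m = int (snd (ds ! i'))"
  by (simp add: mult_tm_def max_def reads_input_registers)

lemma val_beta:
  "reads_input m t ds \<Longrightarrow> val i m = int i' \<Longrightarrow> i' < length ds \<Longrightarrow> val (beta_tm i) m = int (\<beta> i')"
  by (simp add: beta_tm_def val_mult degree_tm_def max_def reads_input_registers \<beta>_def)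

lemma val_N: "reads_input m t ds \<Longrightarrow> val N_tm m = int N"
  unfolding N_tm_def N_def by (rule val_pow) (simp_all add: val_t val_k del: of_nat_Suc)

lemma val_B: "reads_input m t ds \<Longrightarrow> val B_tm m = int B"
  by (simp add: B_tm_def val_N val_t B_def algebra_simps)

lemma val_Q: "reads_input m t ds \<Longrightarrow> val Q_tm m = int Q"
  unfolding Q_tm_def Q_def by (rule val_pow) (simp_all add: val_B val_N val_k)

lemma val_type_digit:
  "reads_input m t ds \<Longrightarrow> val l m = int l' \<Longrightarrow> val i m = int i' \<Longrightarrow>
    val (type_digit_tm l i) m = int (digit (t + 1) l' i')"
  unfolding type_digit_tm_def by (rule val_digit) (simp_all add: val_t)

text \<open>The name \<open>l\<close> must differ from 2 and 3, the loops whose bodies read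
  \<open>Idx l\<close>.\<close>

lemma val_U:
  assumes "reads_input m t ds" "m (idx_addr l) = int l'" "l \<noteq> 2" "l \<noteq> 3"
  shows "val (U_tm l) m = int (U l')"
proof -
  have "val (sum_tm 2 k_tm (type_digit_tm (Idx l) (Idx 2))) m = int (\<Sum>i<length ds. digit (t + 1) l' i)"
    by (rule val_sum) (use assms in \<open>simp_all add: val_k val_type_digit del: of_nat_Suc\<close>)
  moreover have "val (prod_tm 3 k_tm (binomial_tm 4 (mult_tm (Idx 3)) (type_digit_tm (Idx l) (Idx 3)))) m
      = int (\<Prod>i<length ds. snd (ds ! i) choose digit (t + 1) l' i)"
    by (rule val_prod, simp add: assms val_k, rule val_binomial)
      (use assms in \<open>simp_all add: val_mult val_type_digit\<close>)
  ultimately show ?thesis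
    using assms by (simp add: U_tm_def val_eq val_t U_def type_size_def del: of_nat_sum of_nat_prod)
qed

lemma val_total:
  "reads_input m t ds \<Longrightarrow> val total_tm m = int ((\<Sum>i<length ds. \<beta> i) + (\<Sum>l<N. U l))"
  unfolding total_tm_def val.simps bop_val.simps of_nat_add
  by (intro arg_cong2[where f = "(+)"] val_sum) (simp_all add: val_k val_beta val_N val_U)

lemma val_carry_digit:
  "reads_input m t ds \<Longrightarrow> val l m = int l' \<Longrightarrow> val i m = int i' \<Longrightarrow>
    val (carry_digit_tm l i) m = int (digit B l' i')"
  unfolding carry_digit_tm_def by (rule val_digit) (simp_all add: val_B)

lemma val_bin_digit:
  "val l m = int l' \<Longrightarrow> val i m = int i' \<Longrightarrow> val (bin_digit_tm l i) m = int (digit 2 l' i')"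
  unfolding bin_digit_tm_def by (rule val_digit) simp_all

lemma val_bit:
  "m (acc_addr 20) = int p \<Longrightarrow> val a m = int a' \<Longrightarrow> val (bit_tm a) m = int (bit_at p a')"
  by (simp add: bit_tm_def val_mod bit_at_def zdiv_int zmod_int)

lemma int_row_iff:
  "int a + int b = int c + 2 * int d \<longleftrightarrow> a + b = c + 2 * d"
  "int a + int b + int e = int c + 2 * int d \<longleftrightarrow> a + b + e = c + 2 * d"
  by linarith+

lemma val_transition:
  assumes "reads_input m t ds" "m (acc_addr 20) = int p" "m (idx_addr 10) = int \<sigma>"
    "m (idx_addr 11) = int z" "m (idx_addr 8) = int \<sigma>'"
  shows "val transition_tm m = of_bool (transition p \<sigma> z \<sigma>')"
proof -
  have "val (prod_tm 12 k_tm type_row_tm) m = of_bool (\<forall>i<length ds.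
    (\<Sum>l<N. digit (t + 1) l i * digit 2 z l) + digit B \<sigma> i = bit_at p (\<beta> i) + 2 * digit B \<sigma>' i)"
  proof (rule val_all)
    fix i x assume "i < length ds"
    let ?m = "m(idx_addr 12 := int i, acc_addr 12 := x)"
    have "val (sum_tm 13 N_tm (type_digit_tm (Idx 13) (Idx 12) *. bin_digit_tm (Idx 11) (Idx 13))) ?m
      = int (\<Sum>l<N. digit (t + 1) l i * digit 2 z l)"
      by (rule val_sum) (use assms in \<open>simp_all add: val_N val_type_digit val_bin_digit\<close>)
    moreover have "val (carry_digit_tm (Idx 10) (Idx 12)) ?m = int (digit B \<sigma> i)"
      "val (carry_digit_tm (Idx 8) (Idx 12)) ?m = int (digit B \<sigma>' i)"
      "val (bit_tm (beta_tm (Idx 12))) ?m = int (bit_at p (\<beta> i))"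
      using assms \<open>i < length ds\<close> by (simp_all add: val_carry_digit val_bit val_beta)
    ultimately show "val type_row_tm ?m = of_bool ((\<Sum>l<N. digit (t + 1) l i * digit 2 z l) + digit B \<sigma> i
        = bit_at p (\<beta> i) + 2 * digit B \<sigma>' i)"
      unfolding type_row_tm_def val_eq val.simps bop_val.simps
      by (simp only: int_row_iff)
  qed (simp add: assms val_k)
  moreover have "val (prod_tm 14 N_tm slack_row_tm) m = of_bool (\<forall>l<N.
    digit 2 z l + digit 2 z (N + l) + digit B \<sigma> (length ds + l)
      = bit_at p (U l) + 2 * digit B \<sigma>' (length ds + l))"
  proof (rule val_all)
    fix l x assume "l < N"
    let ?m = "m(idx_addr 14 := int l, acc_addr 14 := x)"
    have "val (N_tm +. Idx 14) ?m = int (N + l)" "val (k_tm +. Idx 14) ?m = int (length ds + l)"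
      using assms(1) by (simp_all add: val_N val_k)
    then have "val (bin_digit_tm (Idx 11) (Idx 14)) ?m = int (digit 2 z l)"
      "val (bin_digit_tm (Idx 11) (N_tm +. Idx 14)) ?m = int (digit 2 z (N + l))"
      "val (carry_digit_tm (Idx 10) (k_tm +. Idx 14)) ?m = int (digit B \<sigma> (length ds + l))"
      "val (carry_digit_tm (Idx 8) (k_tm +. Idx 14)) ?m = int (digit B \<sigma>' (length ds + l))"
      "val (bit_tm (U_tm 14)) ?m = int (bit_at p (U l))"
      using assms by (simp_all add: val_carry_digit val_bit val_U val_bin_digit del: val.simps(5))
    then show "val slack_row_tm ?m = of_bool (digit 2 z l + digit 2 z (N + l) + digit B \<sigma> (length ds + l)
      = bit_at p (U l) + 2 * digit B \<sigma>' (length ds + l))"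
      unfolding slack_row_tm_def val_eq val.simps(1,5) bop_val.simps
      by (simp only: int_row_iff)
  qed (simp add: assms val_N)
  ultimately show ?thesis by (simp add: transition_tm_def transition_def)
qed

lemma val_step:
  assumes "reads_input m t ds" "m (acc_addr 20) = int p" "m (idx_addr 20) = int S"
  shows "val step_tm m = int (step_set p S)"
  unfolding step_tm_def step_set_def from_digits_def
proof (rule val_sum)
  fix \<sigma>' x8
  let ?m8 = "m(idx_addr 8 := int \<sigma>', acc_addr 8 := x8)"
  have "val (pow_tm 9 (Cst 2) (Idx 8)) ?m8 = int (2 ^ \<sigma>')"
    by (rule val_pow) simp_all
  moreover have "val (ex_tm 10 Q_tm (ex_tm 11 (pow_tm 9 (Cst 2) (Cst 2 *. N_tm))
      (eq_tm (bin_digit_tm (Idx 20) (Idx 10)) (Cst 1) *. transition_tm))) ?m8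
    = of_bool (\<exists>\<sigma><Q. \<exists>z<2 ^ (2 * N). digit 2 S \<sigma> = 1 \<and> transition p \<sigma> z \<sigma>')"
  proof (rule val_ex, simp add: assms val_Q, rule val_ex)
    fix \<sigma> x10
    let ?m10 = "?m8(idx_addr 10 := int \<sigma>, acc_addr 10 := x10)"
    have "val (Cst 2 *. N_tm) ?m10 = int (2 * N)" using assms by (simp add: val_N)
    then have "val (pow_tm 9 (Cst 2) (Cst 2 *. N_tm)) ?m10 = int (2 ^ (2 * N))"
      by (rule val_pow) simp
    then show "val (pow_tm 9 (Cst 2) (Cst 2 *. N_tm)) ?m10 = int (2 ^ (2 * N))" .
    fix z x11
    let ?m11 = "?m10(idx_addr 11 := int z, acc_addr 11 := x11)"
    have "val transition_tm ?m11 = of_bool (transition p \<sigma> z \<sigma>')"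
      by (rule val_transition) (simp_all add: assms)
    moreover have "val (bin_digit_tm (Idx 20) (Idx 10)) ?m11 = int (digit 2 S \<sigma>)"
      by (rule val_bin_digit) (simp_all add: assms)
    ultimately show "val (eq_tm (bin_digit_tm (Idx 20) (Idx 10)) (Cst 1) *. transition_tm) ?m11
      = of_bool (digit 2 S \<sigma> = 1 \<and> transition p \<sigma> z \<sigma>')"
      by (simp add: val_eq del: fun_upd_apply)
  qed
  ultimately show "val (ex_tm 10 Q_tm (ex_tm 11 (pow_tm 9 (Cst 2) (Cst 2 *. N_tm))
      (eq_tm (bin_digit_tm (Idx 20) (Idx 10)) (Cst 1) *. transition_tm))
    *. pow_tm 9 (Cst 2) (Idx 8)) ?m8
    = int (of_bool (\<exists>\<sigma><Q. \<exists>z<2 ^ (2 * N). digit 2 S \<sigma> = 1 \<and> transition p \<sigma> z \<sigma>') * 2 ^ \<sigma>')"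
    by (simp del: fun_upd_apply)
qed (simp add: assms val_Q)

end

section \<open>The driver and its constants\<close>

text \<open>The added 1 turns the strict test into one for \<open>2 ^ j \<le> total\<close>.\<close>

definition loop_guard :: expr where
  "loop_guard = Add (Sub (rd (idx_addr 21)) (rd (acc_addr 20))) (Const 1)"

definition loop_body :: com where
  "loop_body = Seq (compile step_tm 0) (Seq (put (idx_addr 20) (rd (tmp_addr 0)))
     (Seq (put (tmp_addr 0) (Const 0)) (put (acc_addr 20) (Mul (Const 2) (rd (acc_addr 20))))))"

definition init_com :: com where
  "init_com = Seq (compile total_tm 0) (Seq (put (idx_addr 21) (rd (tmp_addr 0)))
     (Seq (put (tmp_addr 0) (Const 0)) (Seq (put (acc_addr 20) (Const 1)) (put (idx_addr 20) (Const 1)))))"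

text \<open>The lowest bit of the mask tells whether state 0, the vector of zero carries, is
  reachable.\<close>

definition final_com :: com where
  "final_com = put 0 (Sub (rd (idx_addr 20)) (Mul (Const 2) (Div (rd (idx_addr 20)) (Const 2))))"

definition decider :: com where
  "decider = Seq init_com (Seq (While loop_guard loop_body) final_com)"

text \<open>A canonical memory for given parameters. Obliviousness transfers its step counts to all
  inputs, which makes them functions of \<open>k\<close> and \<open>t\<close>.\<close>

definition parameter_mem :: "nat \<Rightarrow> nat \<Rightarrow> mem" where
  "parameter_mem k t a = (if a = 0 then int t else if a = 1 then int k else 0)"

definition init_steps :: "nat \<Rightarrow> nat \<Rightarrow> nat" where
  "init_steps k t = steps total_tm (parameter_mem k t) + 20"

definition body_steps :: "nat \<Rightarrow> nat \<Rightarrow> nat" where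
  "body_steps k t = steps step_tm (parameter_mem k t) + 20"

text \<open>The power covers the growth during initialization, \<open>Q\<close> the length of the
  mask, and 1 the extra bit of the current power of 2.\<close>

definition size_factor :: "nat \<Rightarrow> nat \<Rightarrow> nat" where
  "size_factor k t = (2 ^ init_steps k t + type_program.Q t k + 1)
     * (com_bits decider + bit_size (int t) + bit_size (int k))"

text \<open>Initialization, loop and final command, where 7 and 10 are the node counts of the guard
  and the final command. The factor 2 absorbs the last test of the guard; the cube is quadratic time
  in linearly many rounds.\<close>

definition time_factor :: "nat \<Rightarrow> nat \<Rightarrow> nat" where
  "time_factor k t = (16 ^ init_steps k t + 2 * (16 ^ body_steps k t + 16 ^ 7) + 16 ^ 10) * size_factor k t ^ 3"

lemma agree_parameter_mem:
  "reads_input m t ds \<Longrightarrow> agree {} m (parameter_mem (length ds) t)"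
  by (simp add: agree_def parameter_mem_def reads_input_registers)

lemma bit_size_two_power: "bit_size (2 ^ j) = j + 1"
proof -
  have "bit_size (2 ^ j) \<le> j + 1" by (subst bit_size_le_iff) auto
  moreover have "\<not> bit_size (2 ^ j) \<le> j"
  proof (cases "j = 0")
    case False
    then show ?thesis by (subst bit_size_le_iff) auto
  qed (use bit_size_ge1[of 1] in simp)
  ultimately show ?thesis by simp
qed

lemma input_size_ge:
  "x \<in> set (concat (map (\<lambda>(\<delta>, n). [int \<delta>, int n]) ds)) \<Longrightarrow> bit_size x \<le> input_size ds"
proof -
  assume "x \<in> set (concat (map (\<lambda>(\<delta>, n). [int \<delta>, int n]) ds))"
  then obtain \<delta> n where *: "(\<delta>, n) \<in> set ds" "x = int \<delta> \<or> x = int n" by auto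
  from *(1) have "bit_size (int \<delta>) + bit_size (int n) \<le> input_size ds"
    unfolding input_size_def by (intro member_le_sum_list) auto
  with *(2) show ?thesis by auto
qed

lemma input_mem_bits:
  "mem_bits_le (input_mem (encode_input t ds)) (bit_size (int t) + bit_size (int (length ds)) + input_size ds)"
  unfolding mem_bits_le_def
proof
  fix a
  let ?W = "bit_size (int t) + bit_size (int (length ds)) + input_size ds"
  have "bit_size x \<le> ?W" if "x \<in> set (encode_input t ds)" for x
  proof -
    from that consider "x = int t" | "x = int (length ds)"
      | "x \<in> set (concat (map (\<lambda>(\<delta>, n). [int \<delta>, int n]) ds))"
      unfolding encode_input_def by fastforce
    then show ?thesis by cases (use input_size_ge[of x ds] in auto)
  qed
  moreover have "bit_size 0 \<le> ?W" using bit_size_ge1[of "int t"] by simp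
  ultimately show "bit_size (input_mem (encode_input t ds) a) \<le> ?W"
    by (auto simp: input_mem_def)
qed

section \<open>Execution and running time of the driver\<close>

context hypergraph_input
begin

abbreviation k :: nat where "k \<equiv> length ds"

definition total :: nat where "total = (\<Sum>i<k. \<beta> i) + (\<Sum>l<N. U l)"

definition loop_mem :: "nat \<Rightarrow> mem" where
  "loop_mem j = (input_mem (encode_input t ds))
     (idx_addr 21 := int total, acc_addr 20 := 2 ^ j, idx_addr 20 := int (carry_set j))"

lemma reads_input_mem: "reads_input (input_mem (encode_input t ds)) t ds"
  by (simp add: reads_input_def)

lemma reads_loop_mem: "reads_input (loop_mem j) t ds"
  by (simp add: loop_mem_def reads_input_mem)

lemma input_mem_clean: "clean 0 (input_mem (encode_input t ds))"
  using addr_neg(3) by (simp add: clean_def input_mem_def flip: not_le)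

lemma loop_mem_clean: "clean 0 (loop_mem j)"
  using input_mem_clean by (simp add: clean_def loop_mem_def)

lemma run_init: "run init_com (input_mem (encode_input t ds)) (init_steps k t) (loop_mem 0)"
proof -
  let ?m = "input_mem (encode_input t ds)"
  have v: "val total_tm ?m = int total"
    using val_total[OF reads_input_mem] by (simp add: total_def)
  have s: "steps total_tm ?m = steps total_tm (parameter_mem k t)"
    by (rule steps_oblivious[OF oblivious_total agree_parameter_mem[OF reads_input_mem]])
  have z: "?m (tmp_addr 0) = 0" using cleanD[OF input_mem_clean] by simp
  note c = run_compile[OF input_mem_clean, of total_tm, unfolded v s]
  show ?thesis unfolding init_com_def
    by (rule run_le[OF run.Seq[OF c run.Seq[OF run_put[OF refl] run.Seq[OF run_put[OF refl]
        run.Seq[OF run_put[OF refl] run_put[OF refl]]]]]])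
      (auto simp: init_steps_def loop_mem_def carry_set_0 fun_eq_iff z)
qed

lemma run_body: "run loop_body (loop_mem j) (body_steps k t) (loop_mem (Suc j))"
proof -
  have v: "val step_tm (loop_mem j) = int (carry_set (Suc j))"
    by (subst val_step[OF reads_loop_mem, of j "2 ^ j" "carry_set j"]) (simp_all add: loop_mem_def step_carry_set)
  have s: "steps step_tm (loop_mem j) = steps step_tm (parameter_mem k t)"
    by (rule steps_oblivious[OF oblivious_step agree_parameter_mem[OF reads_loop_mem]])
  have z: "loop_mem j (tmp_addr 0) = 0" using cleanD[OF loop_mem_clean] by simp
  note c = run_compile[OF loop_mem_clean[of j], of step_tm, unfolded v s]
  show ?thesis unfolding loop_body_def
    by (rule run_le[OF run.Seq[OF c run.Seq[OF run_put[OF refl] run.Seq[OF run_put[OF refl] run_put[OF refl]]]]])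
      (use z in \<open>auto simp: body_steps_def loop_mem_def fun_eq_iff\<close>)
qed

lemma run_final: "run final_com (loop_mem j) 10 ((loop_mem j)(0 := int (carry_set j) mod 2))"
  unfolding final_com_def
  by (rule run_le[OF run_put[OF refl]]) (simp_all add: loop_mem_def minus_mult_div_eq_mod)

lemma guard_val: "expr_val loop_guard (loop_mem j) = int total - 2 ^ j + 1"
  by (simp add: loop_guard_def loop_mem_def)

definition rounds :: nat where "rounds = (LEAST j. total < 2 ^ j)"

lemma total_less: "total < 2 ^ rounds"
  unfolding rounds_def by (rule LeastI[of _ total]) simp

lemma le_total: "j < rounds \<Longrightarrow> 2 ^ j \<le> total"
  using not_less_Least[of j "\<lambda>j. total < 2 ^ j"] by (simp add: rounds_def not_less)

lemma rounds_le: "rounds \<le> bit_size (int total)"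
  unfolding rounds_def using abs_less_bit_size[of "int total"]
  by (intro Least_le) simp

lemma com_bits_decider:
  "expr_bits loop_guard \<le> com_bits decider" "com_bits loop_body \<le> com_bits decider"
  "com_bits init_com \<le> com_bits decider" "com_bits final_com \<le> com_bits decider"
  by (simp_all add: decider_def)

text \<open>\<open>run_timed\<close> is applied to one round at a time, always with the same
  \<open>W\<close>; applied to the whole loop it would put the number of rounds into an exponent.
  Here \<open>i\<close> is the number of rounds left, and the 1 in \<open>i + 1\<close> pays for the
  last test.\<close>

lemma exec_loop:
  assumes W: "\<And>j. j \<le> rounds \<Longrightarrow> mem_bits_le (loop_mem j) W" and c: "com_bits decider \<le> W"
    and "i \<le> rounds"
  shows "\<exists>T. exec (While loop_guard loop_body) (loop_mem (rounds - i)) T (loop_mem rounds) \<and>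
    T \<le> (i + 1) * ((16 ^ body_steps k t + 16 ^ 7) * W ^ 2)"
proof -
  have b: "expr_bits loop_guard \<le> W" "com_bits loop_body \<le> W"
    using c com_bits_decider by (auto intro: order_trans)
  have "expr_nodes loop_guard = 7" by (simp add: loop_guard_def)
  then have guard: "expr_time loop_guard (loop_mem j) + bit_size (expr_val loop_guard (loop_mem j)) \<le> 16 ^ 7 * W ^ 2"
    if "j \<le> rounds" for j using guard_bound[OF W[OF that] b(1)] by simp
  show ?thesis using assms(3)
  proof (induction i)
    case 0
    have "expr_val loop_guard (loop_mem rounds) \<le> 0"
    proof -
      have "int total < 2 ^ rounds" using total_less by simp
      then show ?thesis unfolding guard_val by linarith
    qed
    from exec.While_false[OF this] guard[of rounds] show ?case
      by (auto intro!: exI[of _ "expr_time loop_guard (loop_mem rounds) + bit_size (expr_val loop_guard (loop_mem rounds))"]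
          simp: algebra_simps)
  next
    case (Suc i)
    let ?j = "rounds - Suc i"
    have j: "Suc ?j = rounds - i" "?j < rounds" "?j \<le> rounds" using Suc.prems by auto
    have g: "0 < expr_val loop_guard (loop_mem ?j)"
    proof -
      have "2 ^ ?j \<le> int total" using le_total[OF j(2)] by simp
      then show ?thesis unfolding guard_val by linarith
    qed
    have "timed loop_body (loop_mem ?j) (body_steps k t) W (loop_mem (Suc ?j))"
      using run_body W[OF j(3)] b(2) by (rule run_timed)
    then obtain T1 where T1: "exec loop_body (loop_mem ?j) T1 (loop_mem (rounds - i))"
      "T1 \<le> 16 ^ body_steps k t * W ^ 2" unfolding timed_def j(1) by blast
    from Suc obtain T2 where T2: "exec (While loop_guard loop_body) (loop_mem (rounds - i)) T2 (loop_mem rounds)"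
      "T2 \<le> (i + 1) * ((16 ^ body_steps k t + 16 ^ 7) * W ^ 2)" by auto
    from exec.While_true[OF g T1(1) T2(1)] show ?case
    proof (intro exI conjI)
      have "(Suc i + 1) * ((16 ^ body_steps k t + 16 ^ 7) * W ^ 2) = 16 ^ 7 * W ^ 2 + 16 ^ body_steps k t * W ^ 2
          + (i + 1) * ((16 ^ body_steps k t + 16 ^ 7) * W ^ 2)" by (simp add: algebra_simps)
      then show "expr_time loop_guard (loop_mem ?j) + bit_size (expr_val loop_guard (loop_mem ?j)) + T1 + T2
        \<le> (Suc i + 1) * ((16 ^ body_steps k t + 16 ^ 7) * W ^ 2)"
        using guard[OF j(3)] T1(2) T2(2) by linarith
    qed
  qed
qed

lemma init_timed:
  "timed init_com (input_mem (encode_input t ds)) (init_steps k t)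
     (com_bits decider + bit_size (int t) + bit_size (int k) + input_size ds) (loop_mem 0)"
  by (rule run_timed[OF run_init mem_bits_le_mono[OF input_mem_bits]])
    (use com_bits_decider(3) in auto)

text \<open>For \<open>a \<ge> 1\<close>, the inequality \<open>a + b \<le> a * (b + 1)\<close>
  separates the parameters from the input size.\<close>

lemma size_factor_bound:
  "(2 ^ init_steps k t + Q + 1) * (com_bits decider + bit_size (int t) + bit_size (int k) + input_size ds)
    \<le> size_factor k t * (input_size ds + 1)"
proof -
  have "a + b \<le> a * (b + 1)" if "1 \<le> a" for a b :: nat
    using that mult_le_mono1[of 1 a b] by simp
  then show ?thesis
    unfolding size_factor_def mult.assoc using bit_size_ge1[of "int t"] by (intro mult_le_mono2) simp
qed

lemma loop_mem_bits:
  assumes "j \<le> rounds"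
  shows "mem_bits_le (loop_mem j) (size_factor k t * (input_size ds + 1))"
proof -
  let ?V = "com_bits decider + bit_size (int t) + bit_size (int k) + input_size ds"
  let ?Z = "(2 ^ init_steps k t + Q + 1) * ?V"
  have W0: "1 \<le> ?V" using bit_size_ge1[of "int t"] by simp
  have init: "mem_bits_le (loop_mem 0) (2 ^ init_steps k t * ?V)"
    using init_timed by (simp add: timed_def)
  have W1: "2 ^ init_steps k t * ?V + Q + 1 \<le> ?Z"
    using mult_le_mono2[OF W0, of "Q + 1"] by (simp only: distrib_right)
  \<comment> \<open>No binomial coefficient has to be estimated: \<open>total\<close> is the content
    of a register, which the size bound for the initialization covers.\<close>
  have "bit_size (int total) \<le> 2 ^ init_steps k t * ?V"
    using mem_bits_leD[OF init, of "idx_addr 21"] by (simp add: loop_mem_def)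
  then have "bit_size (2 ^ j) \<le> ?Z"
    using W1 assms rounds_le unfolding bit_size_two_power by linarith
  moreover have "1 \<le> Q" using B_ge_2 by (simp add: Q_def Suc_leI)
  then have "bit_size (int (carry_set j)) \<le> Q"
    using carry_set_less[of j] by (simp add: bit_size_le_iff)
  then have "bit_size (int (carry_set j)) \<le> ?Z" using W1 by linarith
  moreover have "mem_bits_le (loop_mem 0) ?Z" using W1 by (intro mem_bits_le_mono[OF init]) linarith
  moreover have "loop_mem j = (loop_mem 0)(acc_addr 20 := 2 ^ j, idx_addr 20 := int (carry_set j))"
    by (auto simp: loop_mem_def)
  ultimately have "mem_bits_le (loop_mem j) ?Z" by (simp only: mem_bits_le_upd)
  then show ?thesis by (rule mem_bits_le_mono[OF _ size_factor_bound])
qed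

text \<open>Every right hand side is a summand of \<open>total\<close>, hence below
  \<open>2 ^ rounds\<close>, so all its bits have been read. The parity of the mask is its digit for
  state 0.\<close>

lemma answer: "int (carry_set rounds) mod 2 = (if hypergraphical t (expand ds) then 1 else 0)"
proof -
  have "\<beta> i < 2 ^ rounds" if "i < k" for i
    using member_le_sum[of i "{..<k}" \<beta>] that total_less by (simp add: total_def)
  moreover have "U l < 2 ^ rounds" if "l < N" for l
    using member_le_sum[of l "{..<N}" U] that total_less by (simp add: total_def)
  ultimately have "digit 2 (carry_set rounds) 0 = 1 \<longleftrightarrow> hypergraphical t (expand ds)"
    unfolding hypergraphical_iff_types by (subst carry_set_final) (simp_all add: N_def \<beta>_def U_def)
  then show ?thesis by (auto simp: digit_def simp flip: zmod_int[of _ 2, simplified])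
qed

lemma decider_correct:
  "decides_within decider (encode_input t ds) (hypergraphical t (expand ds))
     (time_factor k t * (input_size ds + 1) ^ 3)"
proof -
  let ?V = "com_bits decider + bit_size (int t) + bit_size (int k) + input_size ds"
  let ?W = "size_factor k t * (input_size ds + 1)"
  let ?K = "16 ^ body_steps k t + (16 :: nat) ^ 7"
  have W0W: "?V \<le> ?W"
  proof -
    have "?V \<le> (2 ^ init_steps k t + Q + 1) * ?V" by simp
    also note size_factor_bound
    finally show ?thesis .
  qed
  have W: "1 \<le> ?W" using mem_bits_le_pos[OF loop_mem_bits[of 0]] by simp
  have c: "com_bits decider \<le> ?W" using W0W by simp
  from init_timed obtain T1 where T1: "exec init_com (input_mem (encode_input t ds)) T1 (loop_mem 0)"
    "T1 \<le> 16 ^ init_steps k t * ?V ^ 2" unfolding timed_def by blast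
  from exec_loop[OF loop_mem_bits c order.refl] obtain T2 where
    T2: "exec (While loop_guard loop_body) (loop_mem 0) T2 (loop_mem rounds)"
    "T2 \<le> (rounds + 1) * (?K * ?W ^ 2)" by auto
  have "timed final_com (loop_mem rounds) 10 ?W ((loop_mem rounds)(0 := int (carry_set rounds) mod 2))"
    using c com_bits_decider(4) by (intro run_timed[OF run_final loop_mem_bits]) auto
  then obtain T3 where
    T3: "exec final_com (loop_mem rounds) T3 ((loop_mem rounds)(0 := int (carry_set rounds) mod 2))"
    "T3 \<le> 16 ^ 10 * ?W ^ 2" unfolding timed_def by blast
  have e: "exec decider (input_mem (encode_input t ds)) (T1 + (T2 + T3))
      ((loop_mem rounds)(0 := int (carry_set rounds) mod 2))"
    unfolding decider_def by (intro exec.Seq[OF T1(1)] exec.Seq[OF T2(1)] T3(1))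
  have W23: "?W ^ 2 \<le> ?W ^ 3" using W by (intro power_increasing) auto
  have "?V ^ 2 \<le> ?W ^ 3" using power_mono[OF W0W, of 2] W23 by linarith
  then have 1: "T1 \<le> 16 ^ init_steps k t * ?W ^ 3"
    using T1(2) by (meson mult_le_mono2 order_trans)
  have "bit_size (int total) \<le> ?W"
    using mem_bits_leD[OF loop_mem_bits[of 0], of "idx_addr 21"] by (simp add: loop_mem_def)
  then have "rounds + 1 \<le> 2 * ?W" using rounds_le W by linarith
  then have "T2 \<le> (2 * ?W) * (?K * ?W ^ 2)" using T2(2) by (meson mult_le_mono1 order_trans)
  then have 2: "T2 \<le> 2 * ?K * ?W ^ 3" by (simp only: power3_eq_cube power2_eq_square mult_ac)
  have 3: "T3 \<le> 16 ^ 10 * ?W ^ 3" using T3(2) W23 by (meson mult_le_mono2 order_trans)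
  have "time_factor k t * (input_size ds + 1) ^ 3 = (16 ^ init_steps k t + 2 * ?K + 16 ^ 10) * ?W ^ 3"
    unfolding time_factor_def by (simp only: power_mult_distrib mult.assoc)
  then have "T1 + (T2 + T3) \<le> time_factor k t * (input_size ds + 1) ^ 3"
    using 1 2 3 by (simp only: distrib_right)
  with e show ?thesis unfolding decides_within_def answer
    by (intro exI[of _ "T1 + (T2 + T3)"]
        exI[of _ "(loop_mem rounds)(0 := if hypergraphical t (expand ds) then 1 else 0)"]) simp
qed

end

theorem theorem2:
  "\<exists>(A :: com) (f :: nat \<Rightarrow> nat \<Rightarrow> nat) (p :: nat poly).
     \<forall>(t :: nat) (ds :: (nat \<times> nat) list). compressed ds \<longrightarrow>
       decides_within A (encode_input t ds) (hypergraphical t (expand ds))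
         (f (length ds) t * poly p (input_size ds))"
  using hypergraph_input.decider_correct
  \<comment> \<open>The polynomial is the cube of the input size plus 1; the 1 keeps it positive for
    the empty list, whose input size is 0.\<close>
  by (intro exI[of _ decider] exI[of _ time_factor] exI[of _ "[:1, 1:] ^ 3"]) (simp add: add.commute)

end
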